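(* Let $n\ge 1$ be an integer and let $\gamma\ge 0$ be real. There exist constants $C>0$ and $c>0$, independent of $t$, $u_0$ and $u_1$, such that for all $u_0,u_1\in L^2(\mathbf{R}^n)\cap L^{1,\gamma}(\mathbf{R}^n)$, writing $v:=u_0+u_1$ and letting $\hat u$ be the Fourier-side solution associated with $(u_0,u_1)$ (see context), one has $$\left\|\hat u(t)-A^v_{[\gamma]}\,e^{-t|\xi|^2}\right\|_2\le C(1+t)^{-\frac n4-\frac{\gamma}{2}}\|v\|_{1,\gamma}+Ce^{-ct}\big(\|u_0\|_2+\|u_1\|_2+\|v\|_{1,[\gamma]}\big)\qquad\text{for all } t\ge 1 .$$
   Context: Notation. $\mathbf{N}_0=\{0,1,2,\dots\}$; $[r]$ is the largest integer $N\le r$; $\|\cdot\|_2$ is the $L^2(\mathbf{R}^n)$ norm (in the variable $\xi$ for functions of $\xi$). The Fourier transform is $\hat f(\xi)=\int_{\mathbf{R}^n}e^{-ix\cdot\xi}f(x)\,dx$ (extended to $L^2$ as usual). Weighted space: for $\gamma\ge0$, $L^{1,\gamma}(\mathbf{R}^n)=\{f\in L^1(\mathbf{R}^n): \|f\|_{1,\gamma}:=\int_{\mathbf{R}^n}(1+|x|)^\gamma|f(x)|\,dx<\infty\}$. Fourier-side solution: for $u_0,u_1\in L^2(\mathbf{R}^n)$, the solution of the Cauchy problem $u_{tt}-\Delta u+u_t-\Delta u_t=0$, $u(0,x)=u_0(x)$, $u_t(0,x)=u_1(x)$, is regarded as the function whose Fourier transform in $x$ is, for $t\ge0$ and (almost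 every) $\xi$ with $|\xi|\ne1$, $$\hat u(t,\xi)=\frac{e^{-t|\xi|^2}-|\xi|^2e^{-t}}{1-|\xi|^2}\,\widehat{u_0}(\xi)+\frac{e^{-t|\xi|^2}-e^{-t}}{1-|\xi|^2}\,\widehat{u_1}(\xi).$$ Moments: for $v\in L^{1,\gamma}(\mathbf{R}^n)$ and a multi-index $\alpha\in\mathbf{N}_0^n$ with $|\alpha|\le[\gamma]$, $M_\alpha(v)=\frac{(-1)^{|\alpha|}}{\alpha!}\int_{\mathbf{R}^n}x^\alpha v(x)\,dx$. Profile functions: for $k\in\mathbf{N}_0$ and $v\in L^{1,k}(\mathbf{R}^n)$, $$A_k^v(\xi)=\sum_{j=0}^{k/2}|\xi|^{k-2j}\sum_{|\alpha|\le 2j}M_\alpha(v)(i\xi)^\alpha\quad(k\text{ even}),\qquad A_k^v(\xi)=\sum_{j=0}^{(k-1)/2}|\xi|^{k-1-2j}\sum_{|\alpha|\le 2j+1}M_\alpha(v)(i\xi)^\alpha\quad(k\text{ odd}).$$ *)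

theory Defs
  imports "HOL-Analysis.Analysis"
begin

text \<open>
  Functions on \<open>\<real>\<^sup>n\<close> are complex valued and Lebesgue measurable; elements of \<open>L\<^sup>2\<close> and
  \<open>L\<^sup>1\<^sup>,\<^sup>\<gamma>\<close> are represented by functions, not by classes modulo null sets.
\<close>

definition L2_space :: "('a::euclidean_space \<Rightarrow> complex) set" where
  "L2_space = {f \<in> borel_measurable lebesgue. integrable lebesgue (\<lambda>x. (cmod (f x))\<^sup>2)}"

text \<open>Only meaningful on \<^const>\<open>L2_space\<close>: the integral of a non-integrable function is \<open>0\<close>.\<close>

definition L2_norm :: "('a::euclidean_space \<Rightarrow> complex) \<Rightarrow> real" where
  "L2_norm f = sqrt (LINT x|lebesgue. (cmod (f x))\<^sup>2)"

definition L1w_space :: "real \<Rightarrow> ('a::euclidean_space \<Rightarrow> complex) set" where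
  "L1w_space \<gamma> = {f. integrable lebesgue f \<and>
                     integrable lebesgue (\<lambda>x. (1 + norm x) powr \<gamma> * cmod (f x))}"

definition L1w_norm :: "real \<Rightarrow> ('a::euclidean_space \<Rightarrow> complex) \<Rightarrow> real" where
  "L1w_norm \<gamma> f = (LINT x|lebesgue. (1 + norm x) powr \<gamma> * cmod (f x))"

text \<open>
  The integral formula, to be used on \<open>L\<^sup>1\<close> only; on \<open>L\<^sup>1 \<inter> L\<^sup>2\<close> it agrees (almost everywhere)
  with the \<open>L\<^sup>2\<close> extension.
\<close>

definition fourier :: "('a::euclidean_space \<Rightarrow> complex) \<Rightarrow> 'a \<Rightarrow> complex" where
  "fourier f \<xi> = (LINT x|lebesgue. exp (- (\<i> * of_real (x \<bullet> \<xi>))) * f x)"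

text \<open>
  Fourier transform in \<open>x\<close> of the solution of
  \<open>u\<^sub>t\<^sub>t - \<Delta>u + u\<^sub>t - \<Delta>u\<^sub>t = 0\<close>, \<open>u(0) = u\<^sub>0\<close>, \<open>u\<^sub>t(0) = u\<^sub>1\<close>.
  On the null set \<open>|\<xi>| = 1\<close> the value is \<open>0\<close>, by division by zero.
\<close>

definition u_hat ::
  "('a::euclidean_space \<Rightarrow> complex) \<Rightarrow> ('a \<Rightarrow> complex) \<Rightarrow> real \<Rightarrow> 'a \<Rightarrow> complex" where
  "u_hat u0 u1 t \<xi> =
     of_real ((exp (- t * (norm \<xi>)\<^sup>2) - (norm \<xi>)\<^sup>2 * exp (- t)) / (1 - (norm \<xi>)\<^sup>2)) * fourier u0 \<xi>
   + of_real ((exp (- t * (norm \<xi>)\<^sup>2) - exp (- t)) / (1 - (norm \<xi>)\<^sup>2)) * fourier u1 \<xi>"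

type_synonym 'n multi_index = "'n \<Rightarrow> nat"

definition mi_order :: "'n::finite multi_index \<Rightarrow> nat" where
  "mi_order \<alpha> = (\<Sum>i\<in>UNIV. \<alpha> i)"

definition mi_fact :: "'n::finite multi_index \<Rightarrow> real" where
  "mi_fact \<alpha> = (\<Prod>i\<in>UNIV. fact (\<alpha> i))"

definition mi_power :: "'b::comm_semiring_1 ^ 'n::finite \<Rightarrow> 'n multi_index \<Rightarrow> 'b" where
  "mi_power x \<alpha> = (\<Prod>i\<in>UNIV. (x $ i) ^ \<alpha> i)"

lemma finite_mi_order_le: "finite {\<alpha> :: 'n::finite multi_index. mi_order \<alpha> \<le> m}"
proof (rule finite_subset)
  have "\<alpha> i \<le> m" if "mi_order \<alpha> \<le> m" for \<alpha> :: "'n multi_index" and i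
    using that member_le_sum[of i UNIV \<alpha>] by (simp add: mi_order_def)
  then show "{\<alpha> :: 'n multi_index. mi_order \<alpha> \<le> m} \<subseteq> (\<Pi>\<^sub>E i\<in>UNIV. {..m})"
    by auto
qed (rule finite_PiE, auto)

definition moment ::
  "'n::finite multi_index \<Rightarrow> (real ^ 'n \<Rightarrow> complex) \<Rightarrow> complex" where
  "moment \<alpha> v = of_real ((- 1) ^ mi_order \<alpha> / mi_fact \<alpha>)
                  * (LINT x|lebesgue. of_real (mi_power x \<alpha>) * v x)"

definition moment_poly ::
  "nat \<Rightarrow> (real ^ 'n::finite \<Rightarrow> complex) \<Rightarrow> real ^ 'n \<Rightarrow> complex" where
  "moment_poly m v \<xi> =
     (\<Sum>\<alpha> | mi_order \<alpha> \<le> m. moment \<alpha> v * mi_power (\<chi> i. \<i> * of_real (\<xi> $ i)) \<alpha>)"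

definition profile ::
  "nat \<Rightarrow> (real ^ 'n::finite \<Rightarrow> complex) \<Rightarrow> real ^ 'n \<Rightarrow> complex" where
  "profile k v \<xi> =
     (if even k
      then \<Sum>j = 0..k div 2. of_real (norm \<xi> ^ (k - 2 * j)) * moment_poly (2 * j) v \<xi>
      else \<Sum>j = 0..(k - 1) div 2. of_real (norm \<xi> ^ (k - 1 - 2 * j)) * moment_poly (2 * j + 1) v \<xi>)"

end

(*
  Write s = |xi|^2 and K = (e^{-ts} - e^{-t}) / (1 - s).

  Where |xi| <= 1/2, the solution is e^{-ts} v^ / (1 - s) up to an O(e^{-t}) multiple of |u0^| + |u1^|.
  Expanding 1 / (1 - s) as a geometric series and replacing v^ in the l-th term by its Taylor polynomial
  of degree [gamma] - 2l gives exactly the profile.  Each Taylor remainder is O(|xi|^(gamma - 2l)), so the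
  total error is O(|xi|^gamma e^{-ts} ||v||_{1,gamma}), whose L2 norm decays like t^(-n/4 - gamma/2).

  Where |xi| >= 1/2, u^ = e^{-t} u0^ + K v^ with K = O(e^{-t/8}), also across s = 1, and the profile term is
  O((1 + |xi|)^[gamma] e^{-ts}); both are exponentially small in L2.

  The L2 control of u0^, u1^ only needs the inequality ||f^||_2^2 <= (2 pi)^n ||f||_2^2 on L1 and L2, obtained
  by inserting a Gaussian weight e^{-a|xi|^2}, computing its Fourier transform G, and applying
  |f(x) f(y)| <= (|f(x)|^2 + |f(y)|^2) / 2 under the integral against G(x - y), whose mass (2 pi)^n does
  not depend on a.
*)

theory Submission
  imports Defs "HOL-Probability.Characteristic_Functions"
begin

section \<open>Gaussian integrals\<close>

text \<open>The radius 1/2 is a choice: any positive radius below 1 keeps 1 - s away from 0 inside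
  and s away from 0 outside, with other constants. The degrees [gamma] - 2l are the integer parts of
  gamma - 2l; hence the Taylor remainder is needed for real orders between m and m + 1, and
  |xi|^(2l) times |xi|^(gamma - 2l) gives the same power for every l. At high frequency nothing is
  expanded: the profile is merely estimated, which brings in the norm with weight [gamma]. The zero
  of 1 - s on the unit sphere cancels against the difference of the two exponentials; this costs a
  factor t, paid for by half of the exponential rate. The frequency integral is never split: one
  integrable majorant dominates the squared error in both regions. Functions of x are only Lebesgue
  measurable, but their transforms are Borel, so frequency integrals are taken over
  \<open>lborel\<close>.\<close>

lemma has_bochner_integral_gaussian_iexp:
  fixes a y :: real
  assumes "a > 0"
  shows "has_bochner_integral lborel (\<lambda>x. iexp (y * x) * of_real (exp (- a * x\<^sup>2)))
           (complex_of_real (sqrt (pi / a) * exp (- y\<^sup>2 / (4 * a))))"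
proof -
  \<comment> \<open>The substitution u = c x turns u^2 / 2 into a x^2, so the integral becomes the
    characteristic function of the standard normal distribution at y / c.\<close>
  define c where "c = sqrt (2 * a)"
  have c: "c > 0" "c\<^sup>2 = 2 * a"
    using assms by (auto simp: c_def)
  have std: "has_bochner_integral lborel (\<lambda>u. std_normal_density u *\<^sub>R iexp (s * u))
               (complex_of_real (exp (- s\<^sup>2 / 2)))" for s
  proof -
    have "integrable lborel (\<lambda>u. std_normal_density u *\<^sub>R iexp (s * u))"
      by (rule Bochner_Integration.integrable_bound[where f = std_normal_density])
         (auto simp: norm_mult)
    moreover have "(LINT u|lborel. std_normal_density u *\<^sub>R iexp (s * u)) = char std_normal_distribution s"
      unfolding char_def by (subst integral_density) auto
    ultimately show ?thesis
      by (simp add: has_bochner_integral_iff char_std_normal_distribution)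
  qed
  have "has_bochner_integral lborel
          (\<lambda>x. std_normal_density (0 + c * x) *\<^sub>R iexp ((y / c) * (0 + c * x)))
          (complex_of_real (exp (- (y / c)\<^sup>2 / 2)) /\<^sub>R \<bar>c\<bar>)"
    using std[of "y / c"] c(1)
    by (subst lborel_has_bochner_integral_real_affine_iff[symmetric]) auto
  from has_bochner_integral_mult_right[OF this, of "of_real (sqrt (2 * pi))"]
  show ?thesis
  proof (rule has_bochner_integral_cong[THEN iffD1, rotated -1])
    have "(c * x)\<^sup>2 / 2 = a * x\<^sup>2" for x
      using c by (simp add: power_mult_distrib)
    then show "complex_of_real (sqrt (2 * pi)) *
        (std_normal_density (0 + c * x) *\<^sub>R iexp (y / c * (0 + c * x))) =
        iexp (y * x) * of_real (exp (- a * x\<^sup>2))" for x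
      using c(1) by (simp add: std_normal_density_def scaleR_conv_of_real)
    have "sqrt (2 * pi) / c = sqrt (pi / a)"
      using assms by (simp add: c_def real_sqrt_divide real_sqrt_mult)
    moreover have "(y / c)\<^sup>2 / 2 = y\<^sup>2 / (4 * a)"
      using c by (simp add: power_divide)
    ultimately show "complex_of_real (sqrt (2 * pi)) * (complex_of_real (exp (- (y / c)\<^sup>2 / 2)) /\<^sub>R \<bar>c\<bar>)
        = complex_of_real (sqrt (pi / a) * exp (- y\<^sup>2 / (4 * a)))"
      using c(1) by (simp add: scaleR_conv_of_real field_simps flip: of_real_mult of_real_divide)
  qed simp
qed

text \<open>\<open>lborel\<close> is the image of the product of one-dimensional measures under
  expansion in the basis, so Fubini applies coordinatewise. This lifts the Gaussian transform from
  the line to n dimensions.\<close>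

lemma has_bochner_integral_lborel_prod:
  fixes f :: "'a::euclidean_space \<Rightarrow> real \<Rightarrow> 'b::{real_normed_field,banach,second_countable_topology}"
  assumes "\<And>b. b \<in> Basis \<Longrightarrow> has_bochner_integral lborel (f b) (I b)"
  shows "has_bochner_integral lborel (\<lambda>x. \<Prod>b\<in>Basis. f b (x \<bullet> b)) (\<Prod>b\<in>Basis. I b)"
proof -
  interpret product_sigma_finite "\<lambda>_::'a. lborel :: real measure" ..
  have [measurable]: "f b \<in> borel_measurable borel" if "b \<in> Basis" for b
    using borel_measurable_has_bochner_integral[OF assms[OF that]] by simp
  have int: "integrable lborel (f b)" "integral\<^sup>L lborel (f b) = I b" if "b \<in> Basis" for b
    using assms[OF that] by (auto simp: has_bochner_integral_iff)
  have "has_bochner_integral (\<Pi>\<^sub>M b\<in>Basis. lborel) (\<lambda>x. \<Prod>b\<in>Basis. f b (x b)) (\<Prod>b\<in>Basis. I b)"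
    using product_integrable_prod[of Basis f] product_integral_prod[of Basis f] int
    by (simp add: has_bochner_integral_iff)
  then have "has_bochner_integral (\<Pi>\<^sub>M b\<in>Basis. lborel)
      (\<lambda>x. \<Prod>b\<in>Basis. f b ((\<Sum>b'\<in>Basis. x b' *\<^sub>R b') \<bullet> b)) (\<Prod>b\<in>Basis. I b)"
    by (rule has_bochner_integral_cong[THEN iffD1, rotated -1]) (auto intro!: prod.cong)
  then show ?thesis
    by (subst lborel_eq) (auto intro!: has_bochner_integral_distr)
qed

lemma norm_power2_eq_sum_Basis: "(norm x)\<^sup>2 = (\<Sum>b\<in>Basis. (x \<bullet> b)\<^sup>2)"
  for x :: "'a::euclidean_space"
  unfolding power2_norm_eq_inner by (subst euclidean_inner) (simp add: power2_eq_square)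

lemma has_bochner_integral_gaussian_fourier:
  fixes z :: "'a::euclidean_space"
  assumes "a > 0"
  shows "has_bochner_integral lborel (\<lambda>x. iexp (z \<bullet> x) * of_real (exp (- a * (norm x)\<^sup>2)))
           (complex_of_real (sqrt (pi / a) ^ DIM('a) * exp (- (norm z)\<^sup>2 / (4 * a))))"
  using has_bochner_integral_lborel_prod[of "\<lambda>b x. iexp ((z \<bullet> b) * x) * of_real (exp (- a * x\<^sup>2))"
      "\<lambda>b. complex_of_real (sqrt (pi / a) * exp (- (z \<bullet> b)\<^sup>2 / (4 * a)))",
      OF has_bochner_integral_gaussian_iexp[OF assms]]
proof (rule has_bochner_integral_cong[THEN iffD1, rotated -1])
  show "(\<Prod>b\<in>Basis. iexp (z \<bullet> b * (x \<bullet> b)) * complex_of_real (exp (- a * (x \<bullet> b)\<^sup>2)))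
      = iexp (z \<bullet> x) * of_real (exp (- a * (norm x)\<^sup>2))" for x :: 'a
  proof -
    have "z \<bullet> x = (\<Sum>b\<in>Basis. z \<bullet> b * (x \<bullet> b))"
      by (rule euclidean_inner)
    then show ?thesis
      by (simp add: prod.distrib norm_power2_eq_sum_Basis[of x] exp_sum sum_distrib_left
          flip: sum_negf of_real_prod)
  qed
  show "(\<Prod>b\<in>Basis. complex_of_real (sqrt (pi / a) * exp (- (z \<bullet> b)\<^sup>2 / (4 * a))))
      = complex_of_real (sqrt (pi / a) ^ DIM('a) * exp (- (norm z)\<^sup>2 / (4 * a)))"
    by (simp add: prod.distrib norm_power2_eq_sum_Basis[of z] exp_sum sum_divide_distrib
        flip: sum_negf of_real_prod)
qed simp

lemma has_bochner_integral_gaussian: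
  assumes "a > 0"
  shows "has_bochner_integral lborel (\<lambda>x::'a::euclidean_space. exp (- a * (norm x)\<^sup>2)) (sqrt (pi / a) ^ DIM('a))"
proof -
  have "has_bochner_integral lborel (\<lambda>x::'a. complex_of_real (exp (- a * (norm x)\<^sup>2)))
          (of_real (sqrt (pi / a) ^ DIM('a)))"
    using has_bochner_integral_gaussian_fourier[OF assms, of "0::'a"] by simp
  then show ?thesis
    using integral_complex_of_real[of "lborel :: 'a measure" "\<lambda>x. exp (- a * (norm x)\<^sup>2)"]
    by (simp only: has_bochner_integral_iff complex_of_real_integrable_eq of_real_eq_iff)
qed

lemma nn_integral_gaussian:
  assumes "a > 0"
  shows "(\<integral>\<^sup>+x. ennreal (exp (- a * (norm (x::'a::euclidean_space))\<^sup>2)) \<partial>lborel)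
           = ennreal (sqrt (pi / a) ^ DIM('a))"
  using has_bochner_integral_gaussian[OF assms, where 'a = 'a]
  by (simp add: has_bochner_integral_iff nn_integral_eq_integral)

text \<open>Completion leaves the measure of Borel sets unchanged, so a Borel covering by sets of
  finite measure still serves. Sigma-finiteness is what Fubini asks of the Lebesgue factor.\<close>

lemma sigma_finite_lebesgue: "sigma_finite_measure (lebesgue :: 'a::euclidean_space measure)"
proof
  from lborel.sigma_finite_countable obtain A :: "'a set set" where
    "countable A" "A \<subseteq> sets lborel" "\<Union>A = space lborel" "\<forall>a\<in>A. emeasure lborel a \<noteq> \<infinity>"
    by auto
  then show "\<exists>A. countable A \<and> A \<subseteq> sets lebesgue \<and> \<Union>A = space (lebesgue :: 'a measure)
      \<and> (\<forall>a\<in>A. emeasure lebesgue a \<noteq> \<infinity>)"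
    by (intro exI[of _ A]) (auto simp: subset_iff emeasure_completion)
qed

section \<open>The Fourier transform on integrable and square integrable functions\<close>

text \<open>Integrands combine x itself with the merely Lebesgue measurable \<open>f x\<close>; this
  lets x be treated as a Borel map on the completed space.\<close>

lemma measurable_ident_lebesgue: "(\<lambda>x. x) \<in> borel_measurable lebesgue"
  by (rule measurable_completion) simp

lemma measurable_snd_lebesgue [measurable]:
  "snd \<in> borel_measurable (M \<Otimes>\<^sub>M (lebesgue :: 'a::euclidean_space measure))"
  by (rule measurable_compose[OF measurable_snd measurable_ident_lebesgue])

lemma measurable_fst_lebesgue [measurable]:
  "fst \<in> borel_measurable ((lebesgue :: 'a::euclidean_space measure) \<Otimes>\<^sub>M M)"
  by (rule measurable_compose[OF measurable_fst measurable_ident_lebesgue])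

text \<open>The kernel is jointly measurable and the integration runs over x alone, so the result is
  Borel in \<xi> although \<open>f\<close> need not be.\<close>

lemma borel_measurable_fourier [measurable]:
  assumes "integrable lebesgue f"
  shows "fourier f \<in> borel_measurable borel"
proof -
  interpret sigma_finite_measure "lebesgue :: 'a measure" by (rule sigma_finite_lebesgue)
  have [measurable]: "f \<in> borel_measurable lebesgue"
    using assms by simp
  have "(\<lambda>\<xi>. LINT x|lebesgue. exp (- (\<i> * of_real (x \<bullet> \<xi>))) * f x) \<in> borel_measurable borel"
    by measurable
  then show ?thesis
    by (simp add: fourier_def[abs_def])
qed

lemma integrable_fourier:
  assumes "integrable lebesgue f"
  shows "integrable lebesgue (\<lambda>x. exp (- (\<i> * of_real (x \<bullet> \<xi>))) * f x)"
proof -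
  have [measurable]: "f \<in> borel_measurable lebesgue"
    using assms by simp
  note measurable_ident_lebesgue [measurable]
  show ?thesis
    by (rule Bochner_Integration.integrable_bound[OF assms]) (auto simp: norm_mult)
qed

lemma cmod_fourier_le:
  assumes "integrable lebesgue f"
  shows "cmod (fourier f \<xi>) \<le> (LINT x|lebesgue. cmod (f x))"
  unfolding fourier_def
  using integral_norm_bound[of lebesgue "\<lambda>x. exp (- (\<i> * of_real (x \<bullet> \<xi>))) * f x"]
  by (simp add: norm_mult)

lemma fourier_add:
  assumes "integrable lebesgue f" "integrable lebesgue g"
  shows "fourier (\<lambda>x. f x + g x) \<xi> = fourier f \<xi> + fourier g \<xi>"
  using assms unfolding fourier_def
  by (simp add: distrib_left integrable_fourier)

section \<open>The L2 bound for the Fourier transform\<close>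

lemma (in pair_sigma_finite) integrable_pair_mult:
  fixes f :: "'a \<Rightarrow> real" and g :: "'b \<Rightarrow> real"
  assumes "integrable M1 f" "integrable M2 g"
  shows "integrable (M1 \<Otimes>\<^sub>M M2) (\<lambda>(x, y). f x * g y)"
proof (rule Fubini_integrable)
  have [measurable]: "f \<in> borel_measurable M1" "g \<in> borel_measurable M2"
    using assms by auto
  show "(\<lambda>(x, y). f x * g y) \<in> borel_measurable (M1 \<Otimes>\<^sub>M M2)"
    by measurable
qed (use assms in \<open>auto simp: abs_mult\<close>)

text \<open>A non-integrable function has Bochner integral 0, so the bound holds for every
  \<open>f\<close>. Later estimates can thus pass to nonnegative integrals without an integrability
  check on inner integrals.\<close>

lemma ennreal_norm_integral_le:
  "ennreal (norm (integral\<^sup>L M f)) \<le> (\<integral>\<^sup>+x. ennreal (norm (f x)) \<partial>M)"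
  by (cases "integrable M f") (auto intro: integral_norm_bound_ennreal simp: not_integrable_integral_eq)

lemma nn_integral_lborel_shift:
  fixes f :: "'a::euclidean_space \<Rightarrow> ennreal"
  assumes [measurable]: "f \<in> borel_measurable borel"
  shows "(\<integral>\<^sup>+x. f (c + x) \<partial>lborel) = (\<integral>\<^sup>+x. f x \<partial>lborel)"
  by (subst (2) lborel_distr_plus[symmetric, of c]) (simp add: nn_integral_distr)

lemma nn_integral_fourier_gaussian:
  fixes f :: "'a::euclidean_space \<Rightarrow> complex"
  assumes f: "integrable lebesgue f" and f2: "integrable lebesgue (\<lambda>x. (cmod (f x))\<^sup>2)"
    and a: "a > 0"
  shows "(\<integral>\<^sup>+\<xi>. ennreal ((cmod (fourier f \<xi>))\<^sup>2 * exp (- a * (norm \<xi>)\<^sup>2)) \<partial>lborel)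
           \<le> ennreal ((2 * pi) ^ DIM('a) * (LINT x|lebesgue. (cmod (f x))\<^sup>2))"
proof -
  interpret L: sigma_finite_measure "lebesgue :: 'a measure" by (rule sigma_finite_lebesgue)
  interpret P: pair_sigma_finite "lborel :: 'a measure" "lebesgue :: 'a measure" ..
  interpret Q: pair_sigma_finite "lebesgue :: 'a measure" "lebesgue :: 'a measure" ..
  have fm [measurable]: "f \<in> borel_measurable lebesgue"
    using f by simp
  have Fm [measurable]: "fourier f \<in> borel_measurable borel"
    using f by (rule borel_measurable_fourier)
  have [measurable]: "cnj \<in> borel_measurable borel"
    by (intro borel_measurable_continuous_onI continuous_intros)
  define e where "e x \<xi> = exp (- (\<i> * complex_of_real (x \<bullet> \<xi>)))" for x \<xi> :: 'a
  define g where "g \<xi> = exp (- a * (norm \<xi>)\<^sup>2)" for \<xi> :: 'a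
  define G where "G z = sqrt (pi / a) ^ DIM('a) * exp (- (norm z)\<^sup>2 / (4 * a))" for z :: 'a
  define B where "B = (LINT x|lebesgue. cmod (f x))"
  have [measurable]: "g \<in> borel_measurable borel" "G \<in> borel_measurable borel"
    by (simp_all add: g_def[abs_def] G_def[abs_def])
  have [measurable]: "(\<lambda>y. G (y - x)) \<in> borel_measurable lebesgue" "(\<lambda>y. G (x - y)) \<in> borel_measurable lebesgue" for x
    by (rule measurable_completion, simp)+
  have em [measurable]: "(\<lambda>p. e (snd p) (fst p)) \<in> borel_measurable (lborel \<Otimes>\<^sub>M lebesgue)"
    unfolding e_def by measurable
  have em' [measurable]: "(\<lambda>\<xi>. e x \<xi>) \<in> borel_measurable borel" for x
    unfolding e_def by measurable
  have e1: "cmod (e x \<xi>) = 1" for x \<xi>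
    by (simp add: e_def)
  have g0: "g \<xi> \<ge> 0" for \<xi>
    by (simp add: g_def)
  have G0: "G z \<ge> 0" for z
    using a by (simp add: G_def)
  have B0: "B \<ge> 0"
    by (simp add: B_def)
  have F_le: "cmod (fourier f \<xi>) \<le> B" for \<xi>
    unfolding B_def using f by (rule cmod_fourier_le)
  \<comment> \<open>The product of \<open>e x \<xi>\<close> with the conjugate of
    \<open>e y \<xi>\<close> is exp(i (y - x) . \<xi>), so integrating in \<xi> yields the Gaussian
    transform at y - x.\<close>
  have gi: "has_bochner_integral lborel (\<lambda>\<xi>. of_real (g \<xi>) * (e x \<xi> * cnj (e y \<xi>))) (complex_of_real (G (y - x)))" for x y
    using has_bochner_integral_gaussian_fourier[OF a, of "y - x"]
    by (simp add: g_def G_def e_def exp_minus_inverse exp_cnj inner_diff_left mult_exp_exp algebra_simps)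
  have gint: "integrable lborel g"
    using has_bochner_integral_gaussian_fourier[OF a, of "0::'a"]
    by (simp add: has_bochner_integral_iff g_def[abs_def] complex_of_real_integrable_eq)

  have intP: "integrable (lborel \<Otimes>\<^sub>M lebesgue) (\<lambda>(\<xi>, x). (B * g \<xi>) * cmod (f x))"
    using gint f by (intro P.integrable_pair_mult) auto
  \<comment> \<open>One transform stays unexpanded and is bounded by \<open>B\<close>, so a product
    majorant suffices. The two exchanges of integrals are done one after the other instead of
    through a triple integral.\<close>
  have int1: "integrable (lborel \<Otimes>\<^sub>M lebesgue)
      (\<lambda>(\<xi>, x). of_real (g \<xi>) * cnj (fourier f \<xi>) * e x \<xi> * f x)"
  proof (rule Bochner_Integration.integrable_bound[OF intP])
    show "(\<lambda>(\<xi>, x). of_real (g \<xi>) * cnj (fourier f \<xi>) * e x \<xi> * f x) \<in> borel_measurable (lborel \<Otimes>\<^sub>M lebesgue)"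
      unfolding split_beta by measurable
    have "g \<xi> * cmod (fourier f \<xi>) * cmod (f x) \<le> B * g \<xi> * cmod (f x)" for \<xi> x
      using mult_right_mono[OF mult_left_mono[OF F_le[of \<xi>] g0[of \<xi>]] norm_ge_zero[of "f x"]]
      by (simp add: mult_ac)
    then show "AE p in lborel \<Otimes>\<^sub>M lebesgue. norm (case p of (\<xi>, x) \<Rightarrow> of_real (g \<xi>) * cnj (fourier f \<xi>) * e x \<xi> * f x)
        \<le> norm (case p of (\<xi>, x) \<Rightarrow> B * g \<xi> * cmod (f x))"
      by (auto simp: norm_mult e1 g0 B0)
  qed
  have intP2: "integrable (lborel \<Otimes>\<^sub>M lebesgue) (\<lambda>(\<xi>, x). g \<xi> * cmod (f x))"
    using gint f by (intro P.integrable_pair_mult) auto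
  have int2: "integrable (lborel \<Otimes>\<^sub>M lebesgue)
      (\<lambda>(\<xi>, y). of_real (g \<xi>) * e x \<xi> * cnj (e y \<xi> * f y))" for x
    by (rule Bochner_Integration.integrable_bound[OF intP2])
       (auto simp: norm_mult e1 g0 split_beta)

  have inner: "(LINT \<xi>|lborel. of_real (g \<xi>) * cnj (fourier f \<xi>) * e x \<xi>)
      = (LINT y|lebesgue. cnj (f y) * of_real (G (y - x)))" for x
  proof -
    have F_cnj: "cnj (fourier f \<xi>) = (LINT y|lebesgue. cnj (e y \<xi> * f y))" for \<xi>
      unfolding fourier_def e_def by (simp only: Bochner_Integration.integral_cnj)
    have "(LINT \<xi>|lborel. of_real (g \<xi>) * cnj (fourier f \<xi>) * e x \<xi>)
        = (LINT \<xi>|lborel. LINT y|lebesgue. of_real (g \<xi>) * e x \<xi> * cnj (e y \<xi> * f y))"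
      unfolding integral_mult_right_zero F_cnj by (simp only: mult_ac)
    also have "\<dots> = (LINT y|lebesgue. LINT \<xi>|lborel. of_real (g \<xi>) * e x \<xi> * cnj (e y \<xi> * f y))"
      using P.Fubini_integral[OF int2] by simp
    also have "\<dots> = (LINT y|lebesgue. LINT \<xi>|lborel. cnj (f y) * (of_real (g \<xi>) * (e x \<xi> * cnj (e y \<xi>))))"
      by (simp add: mult_ac)
    also have "\<dots> = (LINT y|lebesgue. cnj (f y) * of_real (G (y - x)))"
      unfolding integral_mult_right_zero using gi by (simp add: has_bochner_integral_iff)
    finally show ?thesis .
  qed

  have Fg_int: "integrable lborel (\<lambda>\<xi>. (cmod (fourier f \<xi>))\<^sup>2 * g \<xi>)"
    by (rule Bochner_Integration.integrable_bound[where f = "\<lambda>\<xi>. B\<^sup>2 * g \<xi>"])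
       (use gint F_le g0 in \<open>auto intro!: mult_right_mono power_mono\<close>)
  have "complex_of_real (LINT \<xi>|lborel. (cmod (fourier f \<xi>))\<^sup>2 * g \<xi>)
      = (LINT \<xi>|lborel. LINT x|lebesgue. of_real (g \<xi>) * cnj (fourier f \<xi>) * e x \<xi> * f x)"
  proof -
    have "(LINT x|lebesgue. of_real (g \<xi>) * cnj (fourier f \<xi>) * e x \<xi> * f x)
        = of_real ((cmod (fourier f \<xi>))\<^sup>2 * g \<xi>)" for \<xi>
    proof -
      have "(LINT x|lebesgue. of_real (g \<xi>) * cnj (fourier f \<xi>) * e x \<xi> * f x)
          = (LINT x|lebesgue. (of_real (g \<xi>) * cnj (fourier f \<xi>)) * (e x \<xi> * f x))"
        by (simp add: mult_ac)
      also have "\<dots> = of_real (g \<xi>) * (fourier f \<xi> * cnj (fourier f \<xi>))"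
        unfolding integral_mult_right_zero by (simp add: fourier_def e_def mult_ac)
      finally show ?thesis
        by (simp only: of_real_mult complex_norm_square mult_ac)
    qed
    then show ?thesis
      by (simp only: integral_complex_of_real)
  qed
  also have "\<dots> = (LINT x|lebesgue. LINT \<xi>|lborel. of_real (g \<xi>) * cnj (fourier f \<xi>) * e x \<xi> * f x)"
    using P.Fubini_integral[OF int1] by simp
  also have "\<dots> = (LINT x|lebesgue. f x * (LINT y|lebesgue. cnj (f y) * of_real (G (y - x))))"
    unfolding Bochner_Integration.integral_mult_left_zero inner by (simp only: mult.commute)
  finally have eq: "complex_of_real (LINT \<xi>|lborel. (cmod (fourier f \<xi>))\<^sup>2 * g \<xi>)
      = (LINT x|lebesgue. f x * (LINT y|lebesgue. cnj (f y) * of_real (G (y - x))))" .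

  \<comment> \<open>In each dimension the prefactor sqrt(pi / a) meets the Gaussian mass sqrt(4 pi
    a); the product is 2 pi for every a.\<close>
  have G_tot: "(\<integral>\<^sup>+z. ennreal (G z) \<partial>lborel) = ennreal ((2 * pi) ^ DIM('a))"
  proof -
    have "(\<integral>\<^sup>+z. ennreal (G z) \<partial>lborel)
        = (\<integral>\<^sup>+z. ennreal (sqrt (pi / a) ^ DIM('a)) * ennreal (exp (- (1 / (4 * a)) * (norm (z::'a))\<^sup>2)) \<partial>lborel)"
      using a by (simp add: G_def flip: ennreal_mult)
    also have "\<dots> = ennreal (sqrt (pi / a) ^ DIM('a)) * ennreal (sqrt (pi / (1 / (4 * a))) ^ DIM('a))"
      using a nn_integral_gaussian[of "1 / (4 * a)", where 'a = 'a] by (simp add: nn_integral_cmult)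
    also have "\<dots> = ennreal ((sqrt (pi / a) * sqrt (pi / (1 / (4 * a)))) ^ DIM('a))"
      using a by (simp add: power_mult_distrib flip: ennreal_mult)
    also have "sqrt (pi / a) * sqrt (pi / (1 / (4 * a))) = sqrt ((2 * pi)\<^sup>2)"
      unfolding real_sqrt_mult[symmetric] using a by (simp add: power2_eq_square)
    also have "\<dots> = 2 * pi"
      by (rule real_sqrt_unique) auto
    finally show ?thesis .
  qed
  have G_shift: "(\<integral>\<^sup>+y. ennreal (G (y - x)) \<partial>lebesgue) = ennreal ((2 * pi) ^ DIM('a))" for x
    using nn_integral_lborel_shift[of "\<lambda>z. ennreal (G z)" "- x"]
    by (simp add: nn_integral_completion G_tot)
  \<comment> \<open>Writes the second half of the symmetrised integrand through x - y, so that after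
    exchanging the order of integration its inner integral is again of the form
    \<open>G_shift\<close>.\<close>
  have G_sym: "G (y - x) = G (x - y)" for x y
    by (simp add: G_def norm_minus_commute)

  \<comment> \<open>From here on all integrals are of nonnegative functions, and Tonelli replaces
    Fubini.\<close>
  have "ennreal (LINT \<xi>|lborel. (cmod (fourier f \<xi>))\<^sup>2 * g \<xi>)
      = ennreal (cmod (LINT x|lebesgue. f x * (LINT y|lebesgue. cnj (f y) * of_real (G (y - x)))))"
    unfolding eq[symmetric] norm_of_real by (simp add: g0)
  also have "\<dots> \<le> (\<integral>\<^sup>+x. ennreal (cmod (f x)) * ennreal (cmod (LINT y|lebesgue. cnj (f y) * of_real (G (y - x)))) \<partial>lebesgue)"
    by (rule order_trans[OF ennreal_norm_integral_le]) (simp add: norm_mult ennreal_mult)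
  also have "\<dots> \<le> (\<integral>\<^sup>+x. ennreal (cmod (f x)) * (\<integral>\<^sup>+y. ennreal (cmod (f y) * G (y - x)) \<partial>lebesgue) \<partial>lebesgue)"
    by (intro nn_integral_mono mult_left_mono order_trans[OF ennreal_norm_integral_le])
       (auto simp: norm_mult G0)
  also have "\<dots> = (\<integral>\<^sup>+x. \<integral>\<^sup>+y. ennreal (cmod (f x) * cmod (f y) * G (y - x)) \<partial>lebesgue \<partial>lebesgue)"
    by (intro nn_integral_cong, subst nn_integral_cmult[symmetric])
       (simp_all add: G0 mult.assoc ennreal_mult)
  also have "\<dots> \<le> (\<integral>\<^sup>+x. \<integral>\<^sup>+y. ennreal ((cmod (f x))\<^sup>2 / 2) * ennreal (G (y - x))
      + ennreal ((cmod (f y))\<^sup>2 / 2) * ennreal (G (x - y)) \<partial>lebesgue \<partial>lebesgue)"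
  proof (intro nn_integral_mono)
    fix x y
    have "cmod (f x) * cmod (f y) \<le> (cmod (f x))\<^sup>2 / 2 + (cmod (f y))\<^sup>2 / 2"
      using sum_squares_bound[of "cmod (f x)" "cmod (f y)"] by simp
    from mult_right_mono[OF this G0[of "y - x"]]
    show "ennreal (cmod (f x) * cmod (f y) * G (y - x)) \<le> ennreal ((cmod (f x))\<^sup>2 / 2) * ennreal (G (y - x))
      + ennreal ((cmod (f y))\<^sup>2 / 2) * ennreal (G (x - y))"
      by (simp add: G0 G_sym[of y x] distrib_right flip: ennreal_mult ennreal_plus)
  qed
  also have "\<dots> = (\<integral>\<^sup>+x. \<integral>\<^sup>+y. ennreal ((cmod (f x))\<^sup>2 / 2) * ennreal (G (y - x)) \<partial>lebesgue \<partial>lebesgue)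
      + (\<integral>\<^sup>+x. \<integral>\<^sup>+y. ennreal ((cmod (f y))\<^sup>2 / 2) * ennreal (G (x - y)) \<partial>lebesgue \<partial>lebesgue)"
    by (simp add: nn_integral_add)
  also have "(\<integral>\<^sup>+x. \<integral>\<^sup>+y. ennreal ((cmod (f y))\<^sup>2 / 2) * ennreal (G (x - y)) \<partial>lebesgue \<partial>lebesgue)
      = (\<integral>\<^sup>+y. \<integral>\<^sup>+x. ennreal ((cmod (f y))\<^sup>2 / 2) * ennreal (G (x - y)) \<partial>lebesgue \<partial>lebesgue)"
    by (rule Q.Fubini') measurable
  also have "(\<integral>\<^sup>+x. \<integral>\<^sup>+y. ennreal ((cmod (f x))\<^sup>2 / 2) * ennreal (G (y - x)) \<partial>lebesgue \<partial>lebesgue) + \<dots>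
      = ennreal ((2 * pi) ^ DIM('a)) * ((\<integral>\<^sup>+x. ennreal ((cmod (f x))\<^sup>2 / 2) \<partial>lebesgue) +
        (\<integral>\<^sup>+x. ennreal ((cmod (f x))\<^sup>2 / 2) \<partial>lebesgue))"
    by (simp add: nn_integral_cmult nn_integral_multc G_shift distrib_left mult.commute)
  also have "\<dots> = ennreal ((2 * pi) ^ DIM('a) * (LINT x|lebesgue. (cmod (f x))\<^sup>2))"
    using f2 by (simp add: nn_integral_eq_integral flip: ennreal_plus ennreal_mult)
  finally show ?thesis
    using Fg_int by (simp add: nn_integral_eq_integral g0 g_def)
qed

text \<open>The weights with a = 1 / (m + 1) tend to 1 while the bound does not depend on m, so
  Fatou's lemma removes the weight.\<close>

lemma nn_integral_fourier_le:
  fixes f :: "'a::euclidean_space \<Rightarrow> complex"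
  assumes f: "integrable lebesgue f" and f2: "integrable lebesgue (\<lambda>x. (cmod (f x))\<^sup>2)"
  shows "(\<integral>\<^sup>+\<xi>. ennreal ((cmod (fourier f \<xi>))\<^sup>2) \<partial>lborel)
           \<le> ennreal ((2 * pi) ^ DIM('a) * (LINT x|lebesgue. (cmod (f x))\<^sup>2))"
proof -
  have [measurable]: "fourier f \<in> borel_measurable borel"
    using f by (rule borel_measurable_fourier)
  define h where "h m \<xi> = ennreal ((cmod (fourier f \<xi>))\<^sup>2 * exp (- (1 / Suc m) * (norm \<xi>)\<^sup>2))" for m \<xi>
  have lim: "(\<lambda>m. h m \<xi>) \<longlonglongrightarrow> ennreal ((cmod (fourier f \<xi>))\<^sup>2)" for \<xi>
  proof -
    have "(\<lambda>m. (cmod (fourier f \<xi>))\<^sup>2 * exp (- (1 / Suc m) * (norm \<xi>)\<^sup>2))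
        \<longlonglongrightarrow> (cmod (fourier f \<xi>))\<^sup>2 * exp (- 0 * (norm \<xi>)\<^sup>2)"
      by (intro tendsto_intros LIMSEQ_Suc[OF lim_1_over_n])
    then show ?thesis
      unfolding h_def by (intro tendsto_ennrealI) simp
  qed
  have "(\<integral>\<^sup>+\<xi>. ennreal ((cmod (fourier f \<xi>))\<^sup>2) \<partial>lborel) = (\<integral>\<^sup>+\<xi>. liminf (\<lambda>m. h m \<xi>) \<partial>lborel)"
    by (intro nn_integral_cong) (simp add: lim_imp_Liminf[OF _ lim])
  also have "\<dots> \<le> liminf (\<lambda>m. \<integral>\<^sup>+\<xi>. h m \<xi> \<partial>lborel)"
    by (intro nn_integral_liminf) (simp add: h_def)
  also have "\<dots> \<le> limsup (\<lambda>m. \<integral>\<^sup>+\<xi>. h m \<xi> \<partial>lborel)"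
    by (rule Liminf_le_Limsup) simp
  also have "\<dots> \<le> ennreal ((2 * pi) ^ DIM('a) * (LINT x|lebesgue. (cmod (f x))\<^sup>2))"
    unfolding h_def
    by (intro Limsup_bounded always_eventually allI nn_integral_fourier_gaussian[OF f f2]) simp
  finally show ?thesis .
qed

lemma
  fixes f :: "'a::euclidean_space \<Rightarrow> complex"
  assumes f: "integrable lebesgue f" "f \<in> L2_space"
  shows integrable_fourier_square: "integrable lborel (\<lambda>\<xi>. (cmod (fourier f \<xi>))\<^sup>2)"
    and integral_fourier_square_le:
      "(LINT \<xi>|lborel. (cmod (fourier f \<xi>))\<^sup>2) \<le> (2 * pi) ^ DIM('a) * (L2_norm f)\<^sup>2"
proof -
  have [measurable]: "fourier f \<in> borel_measurable borel"
    using f(1) by (rule borel_measurable_fourier)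
  have f2: "integrable lebesgue (\<lambda>x. (cmod (f x))\<^sup>2)"
    using f(2) by (simp add: L2_space_def)
  have nn: "(\<integral>\<^sup>+\<xi>. ennreal ((cmod (fourier f \<xi>))\<^sup>2) \<partial>lborel) \<le> ennreal ((2 * pi) ^ DIM('a) * (L2_norm f)\<^sup>2)"
    using nn_integral_fourier_le[OF f(1) f2] by (simp add: L2_norm_def)
  then have "(\<integral>\<^sup>+\<xi>. ennreal ((cmod (fourier f \<xi>))\<^sup>2) \<partial>lborel) < \<infinity>"
    by (rule le_less_trans) simp
  then show int: "integrable lborel (\<lambda>\<xi>. (cmod (fourier f \<xi>))\<^sup>2)"
    by (intro integrableI_bounded) auto
  show "(LINT \<xi>|lborel. (cmod (fourier f \<xi>))\<^sup>2) \<le> (2 * pi) ^ DIM('a) * (L2_norm f)\<^sup>2"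
    using nn nn_integral_eq_integral[OF int] by simp
qed

section \<open>The multinomial theorem\<close>

text \<open>Dividing by factorials turns the binomial theorem into a plain Cauchy product, so adding
  one index is one convolution step. Requiring multi-indices to vanish outside A makes their total
  functions canonical and the index set finite.\<close>

lemma multinomial_scaled:
  fixes y :: "'i \<Rightarrow> 'b::{banach,real_normed_field}"
  assumes "finite A"
  shows "(\<Sum>i\<in>A. y i) ^ m /\<^sub>R fact m
    = (\<Sum>\<alpha> | (\<forall>i. i \<notin> A \<longrightarrow> \<alpha> i = 0) \<and> sum \<alpha> A = m. \<Prod>i\<in>A. y i ^ \<alpha> i /\<^sub>R fact (\<alpha> i))"
  using assms
proof (induction A arbitrary: m rule: finite_induct)
  case empty
  have "{\<alpha> :: 'i \<Rightarrow> nat. (\<forall>i. \<alpha> i = 0) \<and> m = 0} = (if m = 0 then {\<lambda>_. 0} else {})"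
    by auto
  then show ?case
    by (simp add: eq_commute[of 0 m])
next
  case (insert a A)
  define S where "S A m = {\<alpha> :: 'i \<Rightarrow> nat. (\<forall>i. i \<notin> A \<longrightarrow> \<alpha> i = 0) \<and> sum \<alpha> A = m}" for A m
  have fin: "finite (S A m)" for m
  proof (rule finite_subset)
    have "\<alpha> i \<le> m" if "\<alpha> \<in> S A m" for \<alpha> i
      using that insert.hyps member_le_sum[of i A \<alpha>] by (cases "i \<in> A") (auto simp: S_def)
    then show "S A m \<subseteq> {\<alpha>. \<forall>i. (i \<in> A \<longrightarrow> \<alpha> i \<in> {..m}) \<and> (i \<notin> A \<longrightarrow> \<alpha> i = 0)}"
      by (auto simp: S_def)
    show "finite {\<alpha> :: 'i \<Rightarrow> nat. \<forall>i. (i \<in> A \<longrightarrow> \<alpha> i \<in> {..m}) \<and> (i \<notin> A \<longrightarrow> \<alpha> i = 0)}"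
      using insert.hyps by (intro finite_set_of_finite_funs) auto
  qed
  have sum_upd: "sum (\<alpha>(a := j)) A = sum \<alpha> A" for \<alpha> :: "'i \<Rightarrow> nat" and j
    using insert.hyps by (intro sum.cong) auto
  have prod_upd: "(\<Prod>i\<in>A. y i ^ (\<alpha>(a := j)) i /\<^sub>R fact ((\<alpha>(a := j)) i)) = (\<Prod>i\<in>A. y i ^ \<alpha> i /\<^sub>R fact (\<alpha> i))"
    for \<alpha> :: "'i \<Rightarrow> nat" and j
    using insert.hyps by (intro prod.cong) auto
  have "(\<Sum>i\<in>insert a A. y i) ^ m /\<^sub>R fact m
      = (\<Sum>j\<le>m. (y a ^ j /\<^sub>R fact j) * ((\<Sum>i\<in>A. y i) ^ (m - j) /\<^sub>R fact (m - j)))"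
    using insert.hyps exp_series_add_commuting[of "y a" "\<Sum>i\<in>A. y i" m] by (simp add: mult.commute)
  also have "\<dots> = (\<Sum>j\<le>m. \<Sum>\<alpha>\<in>S A (m - j). (y a ^ j /\<^sub>R fact j) * (\<Prod>i\<in>A. y i ^ \<alpha> i /\<^sub>R fact (\<alpha> i)))"
    by (simp add: insert.IH S_def sum_distrib_left)
  also have "\<dots> = (\<Sum>(j, \<alpha>)\<in>Sigma {..m} (\<lambda>j. S A (m - j)). (y a ^ j /\<^sub>R fact j) * (\<Prod>i\<in>A. y i ^ \<alpha> i /\<^sub>R fact (\<alpha> i)))"
    using fin by (intro sum.Sigma) auto
  also have "\<dots> = (\<Sum>\<alpha>\<in>S (insert a A) m. \<Prod>i\<in>insert a A. y i ^ \<alpha> i /\<^sub>R fact (\<alpha> i))"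
  \<comment> \<open>A multi-index on \<open>insert a A\<close> corresponds to its value
    \<open>j\<close> at \<open>a\<close> together with the same function reset to 0 at
    \<open>a\<close>, of order \<open>m - j\<close> on A.\<close>
  proof (rule sum.reindex_bij_witness[where i = "\<lambda>\<alpha>. (\<alpha> a, \<alpha>(a := 0))" and j = "\<lambda>(j, \<alpha>). \<alpha>(a := j)"])
    fix p assume p: "p \<in> Sigma {..m} (\<lambda>j. S A (m - j))"
    obtain j \<alpha> where jp: "p = (j, \<alpha>)" by force
    have \<alpha>: "\<alpha> a = 0" "j \<le> m" "\<forall>i. i \<notin> A \<longrightarrow> \<alpha> i = 0" "sum \<alpha> A = m - j"
      using p insert.hyps by (auto simp: jp S_def)
    then have "\<alpha>(a := 0) = \<alpha>"
      by auto
    then show "((case p of (j, \<alpha>) \<Rightarrow> \<alpha>(a := j)) a, (case p of (j, \<alpha>) \<Rightarrow> \<alpha>(a := j))(a := 0)) = p"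
      by (simp add: jp)
    show "(case p of (j, \<alpha>) \<Rightarrow> \<alpha>(a := j)) \<in> S (insert a A) m"
      using \<alpha> insert.hyps sum_upd[of \<alpha> j] by (auto simp: jp S_def)
    show "(\<Prod>i\<in>insert a A. y i ^ (case p of (j, \<alpha>) \<Rightarrow> \<alpha>(a := j)) i /\<^sub>R fact ((case p of (j, \<alpha>) \<Rightarrow> \<alpha>(a := j)) i))
        = (case p of (j, \<alpha>) \<Rightarrow> (y a ^ j /\<^sub>R fact j) * (\<Prod>i\<in>A. y i ^ \<alpha> i /\<^sub>R fact (\<alpha> i)))"
      unfolding jp case_prod_conv prod.insert[OF insert.hyps] prod_upd by simp
  next
    fix \<alpha> assume "\<alpha> \<in> S (insert a A) m"
    then show "(\<alpha> a, \<alpha>(a := 0)) \<in> Sigma {..m} (\<lambda>j. S A (m - j))"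
      using insert.hyps sum_upd[of \<alpha> 0] by (auto simp: S_def)
  qed auto
  finally show ?case
    by (simp add: S_def)
qed

lemma multinomial_mi:
  fixes y :: "'n::finite \<Rightarrow> 'b::{banach,real_normed_field}"
  shows "(\<Sum>i\<in>UNIV. y i) ^ m / fact m
    = (\<Sum>\<alpha> | mi_order \<alpha> = m. (\<Prod>i\<in>UNIV. y i ^ \<alpha> i) / of_real (mi_fact \<alpha>))"
proof -
  have [simp]: "inverse (fact j) *\<^sub>R (z::'b) = z / fact j" for j z
    by (simp add: scaleR_conv_of_real field_simps)
  show ?thesis
    using multinomial_scaled[where A = UNIV and y = y and m = m]
    by (simp add: mi_order_def mi_fact_def prod_dividef)
qed

lemma abs_mi_power_le: "\<bar>mi_power x \<alpha>\<bar> \<le> norm x ^ mi_order \<alpha>"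
  for x :: "real ^ 'n::finite"
  unfolding mi_power_def mi_order_def power_sum abs_prod power_abs
  by (intro prod_mono conjI power_mono component_le_norm_cart) auto

lemma borel_measurable_mi_power [measurable]:
  "(\<lambda>x :: real ^ 'n::finite. mi_power x \<alpha>) \<in> borel_measurable lebesgue"
proof (rule measurable_completion)
  have "continuous_on UNIV (\<lambda>x :: real ^ 'n. mi_power x \<alpha>)"
    unfolding mi_power_def by (intro continuous_intros)
  then show "(\<lambda>x :: real ^ 'n. mi_power x \<alpha>) \<in> borel_measurable lborel"
    by (simp add: borel_measurable_continuous_onI)
qed

section \<open>Moments and the Taylor expansion of the Fourier transform\<close>

lemma L1w_spaceD:
  assumes "v \<in> L1w_space \<gamma>"
  shows "integrable lebesgue v" "v \<in> borel_measurable lebesgue"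
    "integrable lebesgue (\<lambda>x. (1 + norm x) powr \<gamma> * cmod (v x))"
  using assms by (auto simp: L1w_space_def)

lemma L1w_space_mono:
  fixes v :: "'a::euclidean_space \<Rightarrow> complex"
  assumes v: "v \<in> L1w_space \<gamma>" and "\<delta> \<le> \<gamma>"
  shows "v \<in> L1w_space \<delta>"
proof -
  note measurable_ident_lebesgue [measurable] L1w_spaceD(2)[OF v, measurable]
  have "integrable lebesgue (\<lambda>x. (1 + norm x) powr \<delta> * cmod (v x))"
    by (rule Bochner_Integration.integrable_bound[OF L1w_spaceD(3)[OF v]])
       (use assms in \<open>auto intro!: mult_right_mono powr_mono\<close>)
  then show ?thesis
    using L1w_spaceD(1)[OF v] by (simp add: L1w_space_def)
qed

lemma L1w_space_add:
  assumes "f \<in> L1w_space \<gamma>" "g \<in> L1w_space \<gamma>"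
  shows "(\<lambda>x. f x + g x) \<in> L1w_space \<gamma>"
proof -
  note measurable_ident_lebesgue [measurable] L1w_spaceD(2)[OF assms(1), measurable] L1w_spaceD(2)[OF assms(2), measurable]
  have int: "integrable lebesgue (\<lambda>x. (1 + norm x) powr \<gamma> * cmod (f x) + (1 + norm x) powr \<gamma> * cmod (g x))"
    using assms by (intro Bochner_Integration.integrable_add L1w_spaceD)
  have "integrable lebesgue (\<lambda>x. (1 + norm x) powr \<gamma> * cmod (f x + g x))"
    by (rule Bochner_Integration.integrable_bound[OF int])
       (auto simp flip: distrib_left intro!: mult_left_mono norm_triangle_ineq)
  then show ?thesis
    using assms by (simp add: L1w_space_def)
qed

lemma L1w_norm_nonneg: "L1w_norm \<gamma> v \<ge> 0"
  by (simp add: L1w_norm_def)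

lemma one_plus_norm_power_le:
  assumes "real m \<le> \<gamma>"
  shows "(1 + norm x) ^ m \<le> (1 + norm x) powr \<gamma>"
proof -
  have "1 + norm x > 0" by (simp add: add_pos_nonneg)
  then have "(1 + norm x) ^ m = (1 + norm x) powr real m" by (simp add: powr_realpow)
  also have "\<dots> \<le> (1 + norm x) powr \<gamma>" using assms by (intro powr_mono) auto
  finally show ?thesis .
qed

text \<open>The single gateway to the weighted norm: moments, Taylor remainders and moment
  polynomials are all integrals of \<open>v\<close> against a multiplier growing at most like the
  weight.\<close>

lemma L1w_integral_bound:
  fixes v :: "'a::euclidean_space \<Rightarrow> complex"
  assumes v: "v \<in> L1w_space \<gamma>" and [measurable]: "p \<in> borel_measurable lebesgue"
    and le: "\<And>x. cmod (p x) \<le> c * (1 + norm x) powr \<gamma>"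
  shows "integrable lebesgue (\<lambda>x. p x * v x)"
    and "cmod (LINT x|lebesgue. p x * v x) \<le> c * L1w_norm \<gamma> v"
proof -
  note L1w_spaceD[OF v, measurable]
  have c: "c \<ge> 0"
    using order_trans[OF norm_ge_zero le[of 0]] by simp
  have le': "cmod (p x * v x) \<le> c * ((1 + norm x) powr \<gamma> * cmod (v x))" for x
    using mult_right_mono[OF le[of x] norm_ge_zero[of "v x"]] by (simp add: norm_mult mult.assoc)
  have int: "integrable lebesgue (\<lambda>x. c * ((1 + norm x) powr \<gamma> * cmod (v x)))"
    using L1w_spaceD(3)[OF v] by simp
  show "integrable lebesgue (\<lambda>x. p x * v x)"
    by (rule Bochner_Integration.integrable_bound[OF int]) (use c le' in auto)
  show "cmod (LINT x|lebesgue. p x * v x) \<le> c * L1w_norm \<gamma> v"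
    unfolding L1w_norm_def integral_mult_right_zero[symmetric]
    by (rule Bochner_Integration.integral_norm_bound_integral)
       (use \<open>integrable lebesgue (\<lambda>x. p x * v x)\<close> int le' in auto)
qed

lemma integrable_mi_power:
  assumes v: "v \<in> L1w_space \<gamma>" and \<alpha>: "real (mi_order \<alpha>) \<le> \<gamma>"
  shows "integrable lebesgue (\<lambda>x. of_real (mi_power x \<alpha>) * v x)"
proof (rule L1w_integral_bound(1)[OF v, where c = 1])
  show "cmod (of_real (mi_power x \<alpha>)) \<le> 1 * (1 + norm x) powr \<gamma>" for x :: "real ^ 'a"
  proof -
    have "norm x ^ mi_order \<alpha> \<le> (1 + norm x) ^ mi_order \<alpha>"
      by (intro power_mono) auto
    then show ?thesis
      using abs_mi_power_le[of x \<alpha>] one_plus_norm_power_le[OF \<alpha>, of x] by simp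
  qed
qed simp

text \<open>By the multinomial theorem, \<^const>\<open>moment_poly\<close> is the Fourier transform of \<open>v\<close> with the
  exponential truncated after degree \<open>m\<close>.\<close>

lemma moment_poly_eq_integral:
  fixes v :: "real ^ 'n::finite \<Rightarrow> complex"
  assumes v: "v \<in> L1w_space \<gamma>" and m: "real m \<le> \<gamma>"
  shows "moment_poly m v \<xi> = (LINT x|lebesgue. (\<Sum>j\<le>m. (- (\<i> * of_real (x \<bullet> \<xi>))) ^ j / fact j) * v x)"
proof -
  let ?S = "{\<alpha> :: 'n multi_index. mi_order \<alpha> \<le> m}"
  define w where "w = (\<chi> i. \<i> * complex_of_real (\<xi> $ i))"
  define q where "q \<alpha> x = of_real ((- 1) ^ mi_order \<alpha> / mi_fact \<alpha>) * complex_of_real (mi_power x \<alpha>) * mi_power w \<alpha>" for \<alpha> x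
  have int: "integrable lebesgue (\<lambda>x. q \<alpha> x * v x)" if "\<alpha> \<in> ?S" for \<alpha>
  proof -
    have "integrable lebesgue (\<lambda>x. of_real (mi_power x \<alpha>) * v x)"
      using that m by (intro integrable_mi_power[OF v]) simp
    then have "integrable lebesgue
        (\<lambda>x. (of_real ((- 1) ^ mi_order \<alpha> / mi_fact \<alpha>) * mi_power w \<alpha>) * (of_real (mi_power x \<alpha>) * v x))"
      by (rule integrable_mult_right)
    then show ?thesis
      by (simp add: q_def mult_ac)
  qed
  have term_eq: "moment \<alpha> v * mi_power w \<alpha> = (LINT x|lebesgue. q \<alpha> x * v x)" for \<alpha>
  proof -
    have "(LINT x|lebesgue. q \<alpha> x * v x) = (LINT x|lebesgue.
        (of_real ((- 1) ^ mi_order \<alpha> / mi_fact \<alpha>) * mi_power w \<alpha>) * (of_real (mi_power x \<alpha>) * v x))"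
      by (simp add: q_def mult_ac)
    then show ?thesis
      unfolding integral_mult_right_zero by (simp add: moment_def mult_ac)
  qed
  have q_sum: "(\<Sum>\<alpha>\<in>?S. q \<alpha> x) = (\<Sum>j\<le>m. (- (\<i> * of_real (x \<bullet> \<xi>))) ^ j / fact j)" for x
  proof -
    \<comment> \<open>The sign (-1)^|\<alpha>| in the moment turns i \<xi>_i into -i \<xi>_i, so
      \<open>q \<alpha> x\<close> is a multinomial term in numbers \<open>y i\<close> whose sum is
      -i (x . \<xi>).\<close>
    define y where "y i = - (\<i> * complex_of_real (x $ i * \<xi> $ i))" for i
    have q_eq: "q \<alpha> x = (\<Prod>i\<in>UNIV. y i ^ \<alpha> i) / of_real (mi_fact \<alpha>)" for \<alpha>
    proof -
      have "y i ^ \<alpha> i = (- 1) ^ \<alpha> i * of_real ((x $ i) ^ \<alpha> i) * (w $ i) ^ \<alpha> i" for i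
        by (simp add: y_def w_def mult_ac flip: power_mult_distrib)
      then have "(\<Prod>i\<in>UNIV. y i ^ \<alpha> i) = (- 1) ^ mi_order \<alpha> * of_real (mi_power x \<alpha>) * mi_power w \<alpha>"
        by (simp only: prod.distrib mi_power_def mi_order_def power_sum of_real_prod)
      then show ?thesis
        by (simp add: q_def)
    qed
    have "(\<Sum>i\<in>UNIV. y i) = - (\<i> * of_real (x \<bullet> \<xi>))"
      by (simp add: y_def inner_vec_def sum_negf sum_distrib_left)
    then have "(\<Sum>j\<le>m. (- (\<i> * of_real (x \<bullet> \<xi>))) ^ j / fact j) = (\<Sum>j\<le>m. (\<Sum>i\<in>UNIV. y i) ^ j / fact j)"
      by simp
    also have "\<dots> = (\<Sum>j\<le>m. \<Sum>\<alpha> | \<alpha> \<in> ?S \<and> mi_order \<alpha> = j. q \<alpha> x)"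
    proof (rule sum.cong)
      fix j assume "j \<in> {..m}"
      then have "{\<alpha> \<in> ?S. mi_order \<alpha> = j} = {\<alpha>. mi_order \<alpha> = j}"
        by auto
      then show "(\<Sum>i\<in>UNIV. y i) ^ j / fact j = (\<Sum>\<alpha> | \<alpha> \<in> ?S \<and> mi_order \<alpha> = j. q \<alpha> x)"
        by (simp add: multinomial_mi q_eq)
    qed simp
    also have "\<dots> = (\<Sum>\<alpha>\<in>?S. q \<alpha> x)"
      by (rule sum.group) (auto simp: finite_mi_order_le)
    finally show ?thesis by simp
  qed
  have "moment_poly m v \<xi> = (\<Sum>\<alpha>\<in>?S. LINT x|lebesgue. q \<alpha> x * v x)"
    unfolding moment_poly_def w_def[symmetric] by (simp add: term_eq)
  also have "\<dots> = (LINT x|lebesgue. (\<Sum>\<alpha>\<in>?S. q \<alpha> x * v x))"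
    by (rule Bochner_Integration.integral_sum[symmetric]) (rule int)
  also have "\<dots> = (LINT x|lebesgue. (\<Sum>\<alpha>\<in>?S. q \<alpha> x) * v x)"
    by (simp add: sum_distrib_right)
  finally show ?thesis
    by (simp add: q_sum)
qed

section \<open>Taylor remainders of real order\<close>

lemma divide_fact_le: "0 \<le> a \<Longrightarrow> a / fact n \<le> a" for a :: real
  using mult_left_mono[OF fact_ge_1, of a n] by (simp add: divide_le_eq)

text \<open>Interpolates between the two classical remainder bounds: of order |y|^(m + 1), which is
  the smaller for |y| \<le> 1, and of order |y|^m, which is used for |y| > 1. In each range the
  exponent \<theta> lies on the favourable side.\<close>

lemma exp_taylor_powr_bound:
  assumes "real m \<le> \<theta>" "\<theta> \<le> real m + 1"
  shows "cmod (exp (- (\<i> * of_real y)) - (\<Sum>j\<le>m. (- (\<i> * of_real y)) ^ j / fact j)) \<le> 2 * \<bar>y\<bar> powr \<theta>"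
proof (cases "\<bar>y\<bar> \<le> 1")
  case True
  have "cmod (exp (- (\<i> * of_real y)) - (\<Sum>j\<le>m. (- (\<i> * of_real y)) ^ j / fact j)) \<le> \<bar>y\<bar> ^ Suc m / fact (Suc m)"
    using iexp_approx1[of "- y" m] by simp
  also have "\<dots> \<le> \<bar>y\<bar> ^ Suc m"
    by (rule divide_fact_le) simp
  also have "\<dots> \<le> \<bar>y\<bar> powr \<theta>"
  \<comment> \<open>Since \<open>0 powr \<theta>\<close> is 0 even for \<theta> = 0, the point y = 0
    asks for a vanishing bound; the power \<open>Suc m\<close> provides it.\<close>
  proof (cases "y = 0")
    case False
    then have "\<bar>y\<bar> ^ Suc m = \<bar>y\<bar> powr real (Suc m)"
      using powr_realpow[of "\<bar>y\<bar>" "Suc m"] by (simp del: power_Suc of_nat_Suc)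
    then show ?thesis
      using True False assms by (simp add: powr_mono' del: power_Suc)
  qed simp
  finally show ?thesis
    using powr_ge_zero[of "\<bar>y\<bar>" \<theta>] by linarith
next
  case False
  have "cmod (exp (- (\<i> * of_real y)) - (\<Sum>j\<le>m. (- (\<i> * of_real y)) ^ j / fact j)) \<le> 2 * \<bar>y\<bar> ^ m / fact m"
    using iexp_approx2[of "- y" m] by simp
  also have "\<dots> \<le> 2 * \<bar>y\<bar> ^ m"
    by (rule divide_fact_le) simp
  also have "\<bar>y\<bar> ^ m = \<bar>y\<bar> powr real m"
    using False by (intro powr_realpow[symmetric]) auto
  also have "\<dots> \<le> \<bar>y\<bar> powr \<theta>"
    using False assms by (intro powr_mono) auto
  finally show ?thesis by simp
qed

text \<open>Follows from |x . \<xi>|^\<theta> \<le> (1 + |x|)^\<theta> |\<xi>|^\<theta>. Keeping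
  \<theta> separate from \<gamma> allows lower-order expansions, with \<theta> = \<gamma> - 2l, to
  be measured in the one norm of weight \<gamma>.\<close>

lemma fourier_taylor_bound:
  fixes v :: "real ^ 'n::finite \<Rightarrow> complex"
  assumes v: "v \<in> L1w_space \<gamma>" and \<theta>: "real m \<le> \<theta>" "\<theta> \<le> real m + 1" "\<theta> \<le> \<gamma>"
  shows "cmod (fourier v \<xi> - moment_poly m v \<xi>) \<le> 2 * norm \<xi> powr \<theta> * L1w_norm \<gamma> v"
proof -
  note measurable_ident_lebesgue [measurable]
  let ?p = "\<lambda>x. \<Sum>j\<le>m. (- (\<i> * complex_of_real (x \<bullet> \<xi>))) ^ j / fact j"
  let ?e = "\<lambda>x. exp (- (\<i> * complex_of_real (x \<bullet> \<xi>)))"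
  have m: "real m \<le> \<gamma>" and \<theta>0: "\<theta> \<ge> 0"
    using \<theta> by auto
  have le: "cmod (?e x - ?p x) \<le> 2 * norm \<xi> powr \<theta> * (1 + norm x) powr \<gamma>" for x
  proof -
    have "cmod (?e x - ?p x) \<le> 2 * \<bar>x \<bullet> \<xi>\<bar> powr \<theta>"
      by (rule exp_taylor_powr_bound[OF \<theta>(1,2)])
    also have "\<dots> \<le> 2 * ((1 + norm x) * norm \<xi>) powr \<theta>"
      using Cauchy_Schwarz_ineq2[of x \<xi>] \<theta>0
      by (intro mult_left_mono powr_mono2) (auto simp: distrib_right intro: order_trans)
    also have "\<dots> = 2 * norm \<xi> powr \<theta> * (1 + norm x) powr \<theta>"
      by (simp add: powr_mult)
    also have "\<dots> \<le> 2 * norm \<xi> powr \<theta> * (1 + norm x) powr \<gamma>"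
      using \<theta> by (intro mult_left_mono powr_mono) auto
    finally show ?thesis .
  qed
  have meas: "(\<lambda>x. ?e x - ?p x) \<in> borel_measurable lebesgue"
    by measurable
  note bnd = L1w_integral_bound[OF v meas le]
  have e_int: "integrable lebesgue (\<lambda>x. ?e x * v x)"
    by (rule integrable_fourier[OF L1w_spaceD(1)[OF v]])
  have p_int: "integrable lebesgue (\<lambda>x. ?p x * v x)"
    using Bochner_Integration.integrable_diff[OF e_int bnd(1)] by (simp add: left_diff_distrib)
  have "fourier v \<xi> - moment_poly m v \<xi> = (LINT x|lebesgue. (?e x - ?p x) * v x)"
    unfolding left_diff_distrib fourier_def moment_poly_eq_integral[OF v m]
    by (rule Bochner_Integration.integral_diff[symmetric, OF e_int p_int])
  with bnd(2) show ?thesis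
    by simp
qed

text \<open>A crude growth bound for use away from the origin, where a Gaussian absorbs any power of
  1 + |\<xi>|.\<close>

lemma moment_poly_bound:
  fixes v :: "real ^ 'n::finite \<Rightarrow> complex"
  assumes v: "v \<in> L1w_space \<gamma>" and m: "real m \<le> \<gamma>"
  shows "cmod (moment_poly m v \<xi>) \<le> (real m + 1) * (1 + norm \<xi>) ^ m * L1w_norm \<gamma> v"
  unfolding moment_poly_eq_integral[OF v m]
proof (rule L1w_integral_bound(2)[OF v])
  note measurable_ident_lebesgue [measurable]
  show "(\<lambda>x. \<Sum>j\<le>m. (- (\<i> * complex_of_real (x \<bullet> \<xi>))) ^ j / fact j) \<in> borel_measurable lebesgue"
    by measurable
  fix x :: "real ^ 'n"
  \<comment> \<open>Both factors are at least 1, so this one power dominates |x . \<xi>|^j for every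
    j \<le> m; the m + 1 terms give the prefactor.\<close>
  let ?b = "((1 + norm x) * (1 + norm \<xi>)) ^ m"
  have "cmod ((- (\<i> * complex_of_real (x \<bullet> \<xi>))) ^ j / fact j) \<le> ?b" if "j \<le> m" for j
  proof -
    have "cmod ((- (\<i> * complex_of_real (x \<bullet> \<xi>))) ^ j / fact j) = \<bar>x \<bullet> \<xi>\<bar> ^ j / fact j"
      by (simp add: norm_divide norm_power norm_mult)
    also have "\<dots> \<le> \<bar>x \<bullet> \<xi>\<bar> ^ j"
      by (rule divide_fact_le) simp
    also have "\<dots> \<le> ((1 + norm x) * (1 + norm \<xi>)) ^ j"
      using Cauchy_Schwarz_ineq2[of x \<xi>]
      by (intro power_mono) (auto simp: algebra_simps intro!: add_increasing)
    also have "\<dots> \<le> ?b"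
      using that mult_mono[of 1 "1 + norm x" 1 "1 + norm \<xi>"] by (intro power_increasing) auto
    finally show ?thesis .
  qed
  then have "cmod (\<Sum>j\<le>m. (- (\<i> * complex_of_real (x \<bullet> \<xi>))) ^ j / fact j) \<le> (\<Sum>j\<le>m. ?b)"
    by (intro sum_norm_le) auto
  also have "\<dots> = (real m + 1) * (1 + norm \<xi>) ^ m * (1 + norm x) ^ m"
    by (simp add: power_mult_distrib)
  also have "\<dots> \<le> (real m + 1) * (1 + norm \<xi>) ^ m * (1 + norm x) powr \<gamma>"
    by (intro mult_left_mono one_plus_norm_power_le m) auto
  finally show "cmod (\<Sum>j\<le>m. (- (\<i> * complex_of_real (x \<bullet> \<xi>))) ^ j / fact j) \<le> \<dots>" .
qed

text \<open>Reversing the summation index puts both parities into one form, in which |\<xi>|^(2l) is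
  the l-th term of the geometric series of 1 / (1 - |\<xi>|^2).\<close>

lemma profile_eq_sum:
  "profile k v \<xi> = (\<Sum>l\<le>k div 2. of_real (norm \<xi> ^ (2 * l)) * moment_poly (k - 2 * l) v \<xi>)"
proof (cases "even k")
  case True
  then obtain K where k: "k = 2 * K" by (elim evenE)
  have "(\<Sum>j = 0..K. of_real (norm \<xi> ^ (2 * K - 2 * j)) * moment_poly (2 * j) v \<xi>)
      = (\<Sum>l\<le>K. of_real (norm \<xi> ^ (2 * l)) * moment_poly (2 * K - 2 * l) v \<xi>)"
    by (rule sum.reindex_bij_witness[where i = "\<lambda>l. K - l" and j = "\<lambda>l. K - l"])
       (auto simp: diff_mult_distrib2)
  then show ?thesis
    by (simp add: profile_def k)
next
  case False
  then obtain K where k: "k = 2 * K + 1" by (elim oddE)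
  have "(\<Sum>j = 0..K. of_real (norm \<xi> ^ (2 * K - 2 * j)) * moment_poly (2 * j + 1) v \<xi>)
      = (\<Sum>l\<le>K. of_real (norm \<xi> ^ (2 * l)) * moment_poly (2 * K + 1 - 2 * l) v \<xi>)"
    by (rule sum.reindex_bij_witness[where i = "\<lambda>l. K - l" and j = "\<lambda>l. K - l"])
       (auto simp: diff_mult_distrib2 Suc_diff_le)
  then show ?thesis
    by (simp add: profile_def k)
qed

text \<open>There are at most k + 1 summands and each moment polynomial contributes a factor of at
  most k + 1, hence the square. The exponents 2l and k - 2l add up to k.\<close>

lemma profile_bound:
  fixes v :: "real ^ 'n::finite \<Rightarrow> complex"
  assumes v: "v \<in> L1w_space (real k)"
  shows "cmod (profile k v \<xi>) \<le> (real k + 1)\<^sup>2 * (1 + norm \<xi>) ^ k * L1w_norm (real k) v"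
proof -
  let ?b = "(real k + 1) * (1 + norm \<xi>) ^ k * L1w_norm (real k) v"
  have b0: "?b \<ge> 0"
    by (intro mult_nonneg_nonneg L1w_norm_nonneg) auto
  have "cmod (of_real (norm \<xi> ^ (2 * l)) * moment_poly (k - 2 * l) v \<xi>) \<le> ?b" if "l \<le> k div 2" for l
  proof -
    have l: "2 * l \<le> k" using that by linarith
    have "cmod (of_real (norm \<xi> ^ (2 * l)) * moment_poly (k - 2 * l) v \<xi>)
        \<le> (1 + norm \<xi>) ^ (2 * l) * ((real k + 1) * (1 + norm \<xi>) ^ (k - 2 * l) * L1w_norm (real k) v)"
      unfolding norm_mult
    proof (rule mult_mono)
      show "cmod (of_real (norm \<xi> ^ (2 * l))) \<le> (1 + norm \<xi>) ^ (2 * l)"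
        by (simp add: power_mono norm_power)
      show "cmod (moment_poly (k - 2 * l) v \<xi>) \<le> (real k + 1) * (1 + norm \<xi>) ^ (k - 2 * l) * L1w_norm (real k) v"
        by (rule order_trans[OF moment_poly_bound[OF v]])
           (auto intro!: mult_right_mono L1w_norm_nonneg)
    qed auto
    also have "\<dots> = (real k + 1) * ((1 + norm \<xi>) ^ (2 * l) * (1 + norm \<xi>) ^ (k - 2 * l)) * L1w_norm (real k) v"
      by (simp add: mult_ac)
    also have "(1 + norm \<xi>) ^ (2 * l) * (1 + norm \<xi>) ^ (k - 2 * l) = (1 + norm \<xi>) ^ k"
      using l by (simp flip: power_add)
    finally show ?thesis .
  qed
  then have "cmod (profile k v \<xi>) \<le> (\<Sum>l\<le>k div 2. ?b)"
    unfolding profile_eq_sum by (intro sum_norm_le) auto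
  also have "\<dots> = (real (k div 2) + 1) * ?b"
    by simp
  also have "\<dots> \<le> (real k + 1) * ?b"
    using b0 by (intro mult_right_mono) auto
  finally show ?thesis
    by (simp add: power2_eq_square mult.assoc)
qed

text \<open>The hypotheses on k say that k is the integer part of \<gamma>, so \<gamma> - 2l lies
  between k - 2l and k - 2l + 1, and the remainder bound applies with \<theta> = \<gamma> - 2l for
  each l.\<close>

lemma low_frequency_bound:
  fixes v :: "real ^ 'n::finite \<Rightarrow> complex"
  assumes v: "v \<in> L1w_space \<gamma>" and k: "real k \<le> \<gamma>" "\<gamma> < real k + 1" and r: "norm \<xi> \<le> 1 / 2"
  shows "cmod (fourier v \<xi> / of_real (1 - (norm \<xi>)\<^sup>2) - profile k v \<xi>)
    \<le> (real k + 4) * norm \<xi> powr \<gamma> * L1w_norm \<gamma> v"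
proof -
  define s where "s = (norm \<xi>)\<^sup>2"
  define K where "K = k div 2"
  define N where "N = norm \<xi> powr \<gamma> * L1w_norm \<gamma> v"
  have \<gamma>0: "\<gamma> \<ge> 0" using k by linarith
  have s: "0 \<le> s" "s \<le> 1 / 4"
    using power_mono[OF r, of 2] by (auto simp: s_def power2_eq_square)
  have L0: "L1w_norm \<gamma> v \<ge> 0" by (rule L1w_norm_nonneg)
  have N0: "N \<ge> 0" unfolding N_def using L0 by simp
  have s_pow: "s ^ l = norm \<xi> ^ (2 * l)" for l
    by (simp add: s_def power_mult)
  have geo: "1 / (1 - s) = (\<Sum>l\<le>K. s ^ l) + s ^ Suc K / (1 - s)"
  proof -
    have "(1 - s) * (\<Sum>l\<le>K. s ^ l) = 1 - s ^ Suc K"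
      by (rule sum_gp_basic)
    then show ?thesis
      using s by (simp add: field_simps)
  qed
  have geo': "fourier v \<xi> / of_real (1 - s)
      = (\<Sum>l\<le>K. of_real (s ^ l) * fourier v \<xi>) + of_real (s ^ Suc K / (1 - s)) * fourier v \<xi>"
  proof -
    have "fourier v \<xi> / of_real (1 - s) = of_real (1 / (1 - s)) * fourier v \<xi>"
      by simp
    also have "\<dots> = ((\<Sum>l\<le>K. of_real (s ^ l)) + of_real (s ^ Suc K / (1 - s))) * fourier v \<xi>"
      unfolding geo by simp
    finally show ?thesis
      by (simp only: distrib_right sum_distrib_right)
  qed
  have "fourier v \<xi> / of_real (1 - s) - profile k v \<xi>
      = (\<Sum>l\<le>K. of_real (s ^ l) * (fourier v \<xi> - moment_poly (k - 2 * l) v \<xi>))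
        + of_real (s ^ Suc K / (1 - s)) * fourier v \<xi>"
    unfolding geo' profile_eq_sum K_def[symmetric] s_pow[symmetric]
    by (simp only: right_diff_distrib sum_subtractf) simp
  also have "cmod \<dots> \<le> (\<Sum>l\<le>K. 2 * N) + 2 * N"
  proof (intro norm_triangle_mono sum_norm_le)
    fix l assume "l \<in> {..K}"
    then have l: "2 * l \<le> k" by (auto simp: K_def)
    have "cmod (fourier v \<xi> - moment_poly (k - 2 * l) v \<xi>) \<le> 2 * norm \<xi> powr (\<gamma> - 2 * real l) * L1w_norm \<gamma> v"
      using k l by (intro fourier_taylor_bound[OF v]) (auto simp: of_nat_diff)
    then have "s ^ l * cmod (fourier v \<xi> - moment_poly (k - 2 * l) v \<xi>)
        \<le> s ^ l * (2 * norm \<xi> powr (\<gamma> - 2 * real l) * L1w_norm \<gamma> v)"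
      using s by (intro mult_left_mono) auto
    also have "\<dots> = 2 * (norm \<xi> ^ (2 * l) * norm \<xi> powr (\<gamma> - 2 * real l)) * L1w_norm \<gamma> v"
      by (simp add: s_pow)
    also have "norm \<xi> ^ (2 * l) * norm \<xi> powr (\<gamma> - 2 * real l) = norm \<xi> powr \<gamma>"
    \<comment> \<open>At \<xi> = 0 both sides are 0, because \<open>0 powr a\<close> is 0 for every
      exponent, including 0.\<close>
    proof (cases "\<xi> = 0")
      case False
      then have "norm \<xi> ^ (2 * l) = norm \<xi> powr (2 * real l)"
        using powr_realpow[of "norm \<xi>" "2 * l"] by simp
      then show ?thesis
        by (simp flip: powr_add)
    qed simp
    finally show "cmod (of_real (s ^ l) * (fourier v \<xi> - moment_poly (k - 2 * l) v \<xi>)) \<le> 2 * N"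
      using s by (simp add: norm_mult norm_power N_def mult_ac)
  next
    have "s ^ Suc K \<le> norm \<xi> powr \<gamma>"
    proof (cases "\<xi> = 0")
      case True
      then show ?thesis by (simp add: s_def)
    next
      case False
      \<comment> \<open>The geometric tail starts at exponent 2 (K + 1), which is thus at least k +
        1 > \<gamma>; as |\<xi>| < 1, the larger exponent gives the smaller power.\<close>
      have "k + 1 \<le> 2 * Suc K"
        unfolding K_def by presburger
      then have K: "real k + 1 \<le> 2 * real (Suc K)"
        by linarith
      have "s ^ Suc K = norm \<xi> powr (2 * real (Suc K))"
        unfolding s_pow using False powr_realpow[of "norm \<xi>" "2 * Suc K"] by simp
      also have "norm \<xi> powr (2 * real (Suc K)) \<le> norm \<xi> powr \<gamma>"
        using r k K False by (intro powr_mono') auto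
      finally show ?thesis .
    qed
    moreover have "1 / (1 - s) \<le> 2"
      using s by (simp add: field_simps)
    ultimately have "s ^ Suc K * (1 / (1 - s)) \<le> norm \<xi> powr \<gamma> * 2"
      using s by (intro mult_mono) auto
    moreover have "cmod (fourier v \<xi>) \<le> L1w_norm \<gamma> v"
    proof -
      have "(LINT x|lebesgue. cmod (v x)) \<le> L1w_norm \<gamma> v"
        unfolding L1w_norm_def
        using L1w_spaceD[OF v] mult_right_mono[OF one_plus_norm_power_le[of 0 \<gamma>] norm_ge_zero] \<gamma>0
        by (intro integral_mono) auto
      then show ?thesis
        using cmod_fourier_le[OF L1w_spaceD(1)[OF v], of \<xi>] by linarith
    qed
    ultimately have "(s ^ Suc K * (1 / (1 - s))) * cmod (fourier v \<xi>) \<le> (norm \<xi> powr \<gamma> * 2) * L1w_norm \<gamma> v"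
      by (rule mult_mono) auto
    then show "cmod (of_real (s ^ Suc K / (1 - s)) * fourier v \<xi>) \<le> 2 * N"
      using s unfolding norm_mult norm_of_real by (simp add: N_def mult_ac)
  qed
  \<comment> \<open>The K + 1 Taylor remainders and the geometric tail contribute 2 N each.\<close>
  also have "\<dots> = (2 * real K + 4) * N"
    by (simp add: algebra_simps)
  also have "\<dots> \<le> (real k + 4) * N"
  proof -
    have "2 * K \<le> k" by (simp add: K_def)
    then have "2 * real K + 4 \<le> real k + 4" by linarith
    then show ?thesis using N0 by (intro mult_right_mono) auto
  qed
  finally show ?thesis
    by (simp add: s_def N_def mult.assoc)
qed

section \<open>Low and high frequencies\<close>

lemma power_le_fact_exp:
  fixes x :: real
  assumes "x \<ge> 0"
  shows "x ^ n \<le> fact n * exp x"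
proof -
  have "(\<Sum>m\<in>{n}. x ^ m /\<^sub>R fact m) \<le> (\<Sum>m. x ^ m /\<^sub>R fact m)"
    using assms by (intro sum_le_suminf summable_exp_generic) auto
  then show ?thesis
    by (simp add: exp_def field_simps)
qed

lemma powr_le_exp:
  fixes x :: real
  assumes "x \<ge> 0" "0 \<le> a" "a \<le> real n"
  shows "x powr a \<le> (1 + fact n) * exp x"
proof (cases "x \<le> 1")
  case True
  then have "x powr a \<le> 1"
    using assms by (intro powr_le1) auto
  also have "\<dots> \<le> (1 + fact n) * exp x"
    using assms mult_mono[of 1 "1 + fact n" 1 "exp x"] by simp
  finally show ?thesis .
next
  case False
  then have "x powr a \<le> x powr real n"
    using assms by (intro powr_mono) auto
  also have "\<dots> = x ^ n"
    using False by (intro powr_realpow) auto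
  also have "\<dots> \<le> fact n * exp x"
    using assms by (intro power_le_fact_exp) auto
  also have "\<dots> \<le> (1 + fact n) * exp x"
    by (intro mult_right_mono) auto
  finally show ?thesis .
qed

text \<open>Half of the Gaussian is spent on (t r^2)^\<gamma>, which yields the decay t^(-\<gamma>);
  the other half stays integrable and later supplies t^(-n/2).\<close>

lemma powr_gaussian_le:
  fixes r t \<gamma> :: real
  assumes "r \<ge> 0" "t > 0" "0 \<le> \<gamma>" "\<gamma> \<le> real n"
  shows "(r powr \<gamma>)\<^sup>2 * exp (- 2 * t * r\<^sup>2) \<le> (1 + fact n) * t powr (- \<gamma>) * exp (- t * r\<^sup>2)"
proof -
  have "t powr \<gamma> * (r powr \<gamma>)\<^sup>2 = (t * r\<^sup>2) powr \<gamma>"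
    using assms by (simp add: powr_mult power2_eq_square)
  also have "\<dots> \<le> (1 + fact n) * exp (t * r\<^sup>2)"
    using assms by (intro powr_le_exp) auto
  finally have "(r powr \<gamma>)\<^sup>2 \<le> (1 + fact n) * t powr (- \<gamma>) * exp (t * r\<^sup>2)"
    using assms by (simp add: powr_minus field_simps)
  then have "(r powr \<gamma>)\<^sup>2 * exp (- 2 * t * r\<^sup>2) \<le> (1 + fact n) * t powr (- \<gamma>) * exp (t * r\<^sup>2) * exp (- 2 * t * r\<^sup>2)"
    by (intro mult_right_mono) auto
  also have "\<dots> = (1 + fact n) * t powr (- \<gamma>) * exp (- t * r\<^sup>2)"
    by (simp add: mult.assoc mult_exp_exp)
  finally show ?thesis .
qed

text \<open>Because (1 + r)^2 is at most 4 times (1 + r^2) / 2, its k-th power is absorbed by exp((1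
  + r^2) / 2), that is, by half of the Gaussian. The factor \<open>exp 1\<close> generously covers
  exp(1/2).\<close>

lemma one_plus_power_gaussian_le:
  fixes r :: real
  assumes "r \<ge> 0"
  shows "(1 + r) ^ (2 * k) * exp (- r\<^sup>2) \<le> 4 ^ k * fact k * exp 1 * exp (- (1 / 2) * r\<^sup>2)"
proof -
  have "(1 + r)\<^sup>2 \<le> 4 * ((1 + r\<^sup>2) / 2)"
    using sum_squares_bound[of 1 r] by (simp add: power2_eq_square algebra_simps)
  then have "((1 + r)\<^sup>2) ^ k \<le> (4 * ((1 + r\<^sup>2) / 2)) ^ k"
    by (intro power_mono) auto
  also have "\<dots> = 4 ^ k * ((1 + r\<^sup>2) / 2) ^ k"
    by (rule power_mult_distrib)
  also have "\<dots> \<le> 4 ^ k * (fact k * exp ((1 + r\<^sup>2) / 2))"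
    by (intro mult_left_mono power_le_fact_exp) auto
  finally have "(1 + r) ^ (2 * k) * exp (- r\<^sup>2) \<le> 4 ^ k * (fact k * exp ((1 + r\<^sup>2) / 2)) * exp (- r\<^sup>2)"
    unfolding power_mult by (intro mult_right_mono) auto
  also have "\<dots> = 4 ^ k * fact k * exp (1 / 2 - (1 / 2) * r\<^sup>2)"
    by (simp add: mult.assoc mult_exp_exp field_simps)
  also have "\<dots> \<le> 4 ^ k * fact k * exp (1 + - (1 / 2) * r\<^sup>2)"
    by (intro mult_left_mono) auto
  finally show ?thesis
    by (simp only: exp_add mult.assoc)
qed

text \<open>A mean value estimate derived from 1 + x \<le> exp x. The factor |a - b| is what cancels
  the denominator 1 - s.\<close>

lemma exp_minus_diff_le:
  fixes a b m :: real
  assumes "m \<le> a" "m \<le> b"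
  shows "\<bar>exp (- a) - exp (- b)\<bar> \<le> \<bar>a - b\<bar> * exp (- m)"
proof -
  have *: "\<bar>exp (- a) - exp (- b)\<bar> \<le> \<bar>a - b\<bar> * exp (- m)" if "a \<le> b" "m \<le> a" for a b
  proof -
    have "\<bar>exp (- a) - exp (- b)\<bar> = (1 - exp (a - b)) * exp (- a)"
      using that by (simp add: left_diff_distrib mult_exp_exp)
    also have "\<dots> \<le> (b - a) * exp (- m)"
    proof (rule mult_mono)
      show "1 - exp (a - b) \<le> b - a"
        using exp_ge_add_one_self[of "a - b"] by linarith
    qed (use that in auto)
    finally show ?thesis
      using that by simp
  qed
  show ?thesis
    using *[of a b] *[of b a] assms by (cases "a \<le> b") (auto simp: abs_minus_commute)
qed

text \<open>Both exponents t s and t are at least t / 4, so the difference of exponentials is at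
  most t |1 - s| exp(-t / 4), uniformly near s = 1. The factor t is absorbed through (t / 8) exp(-t
  / 8) \<le> 1, leaving the rate 1/8. At s = 1 itself the quotient is 0 by division by zero.\<close>

lemma high_frequency_kernel_le:
  fixes s t :: real
  assumes "s \<ge> 1 / 4" "t \<ge> 0"
  shows "\<bar>(exp (- t * s) - exp (- t)) / (1 - s)\<bar> \<le> 8 * exp (- t / 8)"
proof (cases "s = 1")
  case False
  have "\<bar>exp (- (t * s)) - exp (- t)\<bar> \<le> \<bar>t * s - t\<bar> * exp (- (t / 4))"
    using assms mult_left_mono[of "1 / 4" s t] by (intro exp_minus_diff_le) auto
  also have "\<bar>t * s - t\<bar> = t * \<bar>1 - s\<bar>"
    using assms by (simp add: abs_mult_pos' right_diff_distrib abs_minus_commute)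
  finally have "\<bar>(exp (- t * s) - exp (- t)) / (1 - s)\<bar> \<le> t * exp (- (t / 4))"
    using False by (simp add: abs_divide divide_le_eq mult_ac)
  also have "\<dots> = 8 * ((t / 8) * exp (- (t / 8))) * exp (- (t / 8))"
    by (simp add: mult.assoc mult_exp_exp)
  also have "(t / 8) * exp (- (t / 8)) \<le> 1"
    using exp_ge_add_one_self[of "t / 8"] by (simp add: exp_minus field_simps)
  finally show ?thesis
    by simp
qed simp

section \<open>Pointwise bounds for the squared error\<close>

lemma power2_sum_le: "(a + b)\<^sup>2 \<le> 2 * a\<^sup>2 + 2 * b\<^sup>2" for a b :: real
  using sum_squares_bound[of a b] by (simp add: power2_sum)

lemma borel_measurable_profile [measurable]:
  "profile k v \<in> borel_measurable borel"
  unfolding profile_eq_sum[abs_def] moment_poly_def mi_power_def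
  by (intro borel_measurable_continuous_onI continuous_intros)

lemma borel_measurable_u_hat:
  assumes [measurable]: "integrable lebesgue u0" "integrable lebesgue u1"
  shows "u_hat u0 u1 t \<in> borel_measurable borel"
  unfolding u_hat_def[abs_def] by measurable

lemma low_frequency_square_le:
  fixes u0 u1 :: "real ^ 'n::finite \<Rightarrow> complex"
  assumes u0: "u0 \<in> L1w_space \<gamma>" and u1: "u1 \<in> L1w_space \<gamma>" and v: "v = (\<lambda>x. u0 x + u1 x)"
    and k: "real k \<le> \<gamma>" "\<gamma> < real k + 1" and r: "norm \<xi> \<le> 1 / 2" and t: "t \<ge> 1"
  shows "(cmod (u_hat u0 u1 t \<xi> - profile k v \<xi> * of_real (exp (- t * (norm \<xi>)\<^sup>2))))\<^sup>2
    \<le> 2 * (real k + 4)\<^sup>2 * (1 + fact (k + 1)) * ((L1w_norm \<gamma> v)\<^sup>2 * t powr (- \<gamma>) * exp (- t * (norm \<xi>)\<^sup>2))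
      + 16 * (exp (- t / 4) * ((cmod (fourier u0 \<xi>))\<^sup>2 + (cmod (fourier u1 \<xi>))\<^sup>2))"
proof -
  define s where "s = (norm \<xi>)\<^sup>2"
  define N where "N = L1w_norm \<gamma> v"
  define a where "a = cmod (fourier u0 \<xi>)"
  define b where "b = cmod (fourier u1 \<xi>)"
  define X where "X = (real k + 4) * norm \<xi> powr \<gamma> * N * exp (- t * s)"
  have s: "0 \<le> s" "s \<le> 1 / 4"
    using power_mono[OF r, of 2] by (auto simp: s_def power2_eq_square)
  have vm: "v \<in> L1w_space \<gamma>"
    unfolding v by (rule L1w_space_add[OF u0 u1])
  have fv: "fourier v \<xi> = fourier u0 \<xi> + fourier u1 \<xi>"
    unfolding v by (intro fourier_add L1w_spaceD(1)[OF u0] L1w_spaceD(1)[OF u1])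
  have ab0: "a \<ge> 0" "b \<ge> 0" by (auto simp: a_def b_def)
  have "u_hat u0 u1 t \<xi> - profile k v \<xi> * of_real (exp (- t * s))
      = of_real (exp (- t * s)) * (fourier v \<xi> / of_real (1 - s) - profile k v \<xi>)
        - of_real (exp (- t) / (1 - s)) * (of_real s * fourier u0 \<xi> + fourier u1 \<xi>)"
    unfolding u_hat_def fv s_def[symmetric]
    by (simp add: diff_divide_distrib add_divide_distrib algebra_simps)
  also have "cmod \<dots> \<le> X + 2 * exp (- t) * (a + b)"
  proof (rule norm_triangle_le_diff[OF add_mono])
    show "cmod (of_real (exp (- t * s)) * (fourier v \<xi> / of_real (1 - s) - profile k v \<xi>)) \<le> X"
      using mult_left_mono[OF low_frequency_bound[OF vm k r], of "exp (- t * s)"]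
      by (simp add: norm_mult X_def N_def s_def mult_ac)
    have "cmod (of_real s * fourier u0 \<xi> + fourier u1 \<xi>) \<le> s * a + b"
      using norm_triangle_ineq[of "of_real s * fourier u0 \<xi>" "fourier u1 \<xi>"] s
      by (simp add: norm_mult a_def b_def)
    also have "\<dots> \<le> a + b"
      using s ab0 by (simp add: mult_left_le_one_le)
    finally have 1: "cmod (of_real s * fourier u0 \<xi> + fourier u1 \<xi>) \<le> a + b" .
    have 2: "exp (- t) / (1 - s) \<le> 2 * exp (- t)"
      using s by (simp add: field_simps)
    show "cmod (of_real (exp (- t) / (1 - s)) * (of_real s * fourier u0 \<xi> + fourier u1 \<xi>)) \<le> 2 * exp (- t) * (a + b)"
      unfolding norm_mult norm_of_real using mult_mono[OF 2 1] s by simp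
  qed
  finally have "(cmod (u_hat u0 u1 t \<xi> - profile k v \<xi> * of_real (exp (- t * s))))\<^sup>2 \<le> (X + 2 * exp (- t) * (a + b))\<^sup>2"
    by (rule power_mono) simp
  also have "\<dots> \<le> 2 * X\<^sup>2 + 2 * (2 * exp (- t) * (a + b))\<^sup>2"
    by (rule power2_sum_le)
  also have "X\<^sup>2 \<le> (real k + 4)\<^sup>2 * (1 + fact (k + 1)) * (N\<^sup>2 * t powr (- \<gamma>) * exp (- t * s))"
  proof -
    \<comment> \<open>The integer k + 1 lies above \<gamma>, hence the factorial of k + 1 in the
      constant.\<close>
    have "X\<^sup>2 = (real k + 4)\<^sup>2 * N\<^sup>2 * ((norm \<xi> powr \<gamma>)\<^sup>2 * exp (- 2 * t * s))"
      by (simp add: X_def power_mult_distrib power2_eq_square mult_exp_exp)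
    also have "\<dots> \<le> (real k + 4)\<^sup>2 * N\<^sup>2 * ((1 + fact (k + 1)) * t powr (- \<gamma>) * exp (- t * s))"
      unfolding s_def using t k by (intro mult_left_mono powr_gaussian_le) auto
    finally show ?thesis
      by (simp add: mult_ac)
  qed
  also have "(2 * exp (- t) * (a + b))\<^sup>2 \<le> 8 * (exp (- t / 4) * (a\<^sup>2 + b\<^sup>2))"
  proof -
    have "(2 * exp (- t) * (a + b))\<^sup>2 = 4 * exp (- 2 * t) * (a + b)\<^sup>2"
      by (simp add: power2_eq_square mult_exp_exp)
    \<comment> \<open>The rate 2 t is weakened to t / 4 to agree with the high-frequency bound, so
      that both regions share one term.\<close>
    also have "\<dots> \<le> 4 * exp (- t / 4) * (2 * a\<^sup>2 + 2 * b\<^sup>2)"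
      using t power2_sum_le by (intro mult_mono) auto
    finally show ?thesis
      by (simp add: algebra_simps)
  qed
  finally show ?thesis
    by (simp add: s_def N_def a_def b_def mult.assoc)
qed

text \<open>Only the weight k enters: the profile is built from moments up to order k and no Taylor
  remainder occurs. This is the origin of the norm with weight [\<gamma>] in the exponentially
  decaying term.\<close>

lemma high_frequency_square_le:
  fixes u0 u1 :: "real ^ 'n::finite \<Rightarrow> complex"
  assumes u0: "u0 \<in> L1w_space (real k)" and u1: "u1 \<in> L1w_space (real k)" and v: "v = (\<lambda>x. u0 x + u1 x)"
    and r: "norm \<xi> \<ge> 1 / 2" and t: "t \<ge> 1"
  shows "(cmod (u_hat u0 u1 t \<xi> - profile k v \<xi> * of_real (exp (- t * (norm \<xi>)\<^sup>2))))\<^sup>2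
    \<le> 324 * (exp (- t / 4) * ((cmod (fourier u0 \<xi>))\<^sup>2 + (cmod (fourier u1 \<xi>))\<^sup>2))
      + 2 * (real k + 1) ^ 4 * (4 ^ k * fact k * exp 1)
        * (exp (- t / 4) * ((L1w_norm (real k) v)\<^sup>2 * exp (- (1 / 2) * (norm \<xi>)\<^sup>2)))"
proof -
  define s where "s = (norm \<xi>)\<^sup>2"
  define N where "N = L1w_norm (real k) v"
  define a where "a = cmod (fourier u0 \<xi>)"
  define b where "b = cmod (fourier u1 \<xi>)"
  define p where "p = (exp (- t * s) - s * exp (- t)) / (1 - s)"
  define q where "q = (exp (- t * s) - exp (- t)) / (1 - s)"
  define Y where "Y = (real k + 1)\<^sup>2 * (1 + norm \<xi>) ^ k * N * exp (- t * s)"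
  have s: "s \<ge> 1 / 4"
    using power_mono[OF r, of 2] by (auto simp: s_def power2_eq_square)
  have vm: "v \<in> L1w_space (real k)"
    unfolding v by (rule L1w_space_add[OF u0 u1])
  have ab0: "a \<ge> 0" "b \<ge> 0" by (auto simp: a_def b_def)
  have q: "\<bar>q\<bar> \<le> 8 * exp (- t / 8)"
    unfolding q_def using s t by (intro high_frequency_kernel_le) auto
  have "\<bar>(exp (- t * s) - s * exp (- t)) / (1 - s)\<bar> \<le> 9 * exp (- t / 8)"
  \<comment> \<open>Off the sphere p = q + exp(-t), which gives 8 + 1 = 9. On it p is 0 by division
    by zero and this identity fails, so that case stands apart.\<close>
  proof (cases "s = 1")
    case False
    then have "(exp (- t * s) - s * exp (- t)) / (1 - s) = q + exp (- t)"
      by (simp add: q_def field_simps)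
    moreover have "exp (- t) \<le> exp (- t / 8)"
      using t by simp
    ultimately show ?thesis
      using q exp_ge_zero[of "- t"] by linarith
  qed simp
  then have p: "\<bar>p\<bar> \<le> 9 * exp (- t / 8)"
    by (simp add: p_def)
  have u: "cmod (u_hat u0 u1 t \<xi>) \<le> 9 * exp (- t / 8) * a + 9 * exp (- t / 8) * b"
    unfolding u_hat_def s_def[symmetric] p_def[symmetric] q_def[symmetric]
  proof (intro norm_triangle_le add_mono)
    show "cmod (of_real p * fourier u0 \<xi>) \<le> 9 * exp (- t / 8) * a"
      unfolding norm_mult norm_of_real a_def by (intro mult_right_mono p) auto
    have "\<bar>q\<bar> \<le> 9 * exp (- t / 8)"
      using q exp_ge_zero[of "- t / 8"] by linarith
    then show "cmod (of_real q * fourier u1 \<xi>) \<le> 9 * exp (- t / 8) * b"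
      unfolding norm_mult norm_of_real b_def by (intro mult_right_mono) auto
  qed
  have "cmod (u_hat u0 u1 t \<xi> - profile k v \<xi> * of_real (exp (- t * s))) \<le> 9 * exp (- t / 8) * (a + b) + Y"
  proof (rule norm_triangle_le_diff[OF add_mono])
    show "cmod (u_hat u0 u1 t \<xi>) \<le> 9 * exp (- t / 8) * (a + b)"
      using u by (simp add: distrib_left)
    show "cmod (profile k v \<xi> * of_real (exp (- t * s))) \<le> Y"
      using mult_right_mono[OF profile_bound[OF vm], of "exp (- t * s)" \<xi>]
      by (simp add: norm_mult Y_def N_def)
  qed
  then have "(cmod (u_hat u0 u1 t \<xi> - profile k v \<xi> * of_real (exp (- t * s))))\<^sup>2 \<le> (9 * exp (- t / 8) * (a + b) + Y)\<^sup>2"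
    by (rule power_mono) simp
  also have "\<dots> \<le> 2 * (9 * exp (- t / 8) * (a + b))\<^sup>2 + 2 * Y\<^sup>2"
    by (rule power2_sum_le)
  also have "(9 * exp (- t / 8) * (a + b))\<^sup>2 \<le> 162 * (exp (- t / 4) * (a\<^sup>2 + b\<^sup>2))"
  proof -
    have "(9 * exp (- t / 8) * (a + b))\<^sup>2 = 81 * exp (- t / 4) * (a + b)\<^sup>2"
      by (simp add: power2_eq_square mult_exp_exp)
    also have "\<dots> \<le> 81 * exp (- t / 4) * (2 * a\<^sup>2 + 2 * b\<^sup>2)"
      by (intro mult_left_mono power2_sum_le) auto
    finally show ?thesis
      by (simp add: algebra_simps)
  qed
  also have "Y\<^sup>2 \<le> (real k + 1) ^ 4 * (4 ^ k * fact k * exp 1) * (exp (- t / 4) * (N\<^sup>2 * exp (- (1 / 2) * s)))"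
  proof -
    have "Y\<^sup>2 = (real k + 1) ^ 4 * N\<^sup>2 * ((1 + norm \<xi>) ^ (2 * k) * exp (- 2 * t * s))"
    proof -
      have "(exp (- t * s))\<^sup>2 = exp (- 2 * t * s)"
        by (simp add: power2_eq_square mult_exp_exp)
      then show ?thesis
        unfolding Y_def power_mult_distrib power_mult[symmetric] by (simp add: mult_ac)
    qed
    also have "\<dots> \<le> (real k + 1) ^ 4 * N\<^sup>2 * ((1 + norm \<xi>) ^ (2 * k) * (exp (- t / 4) * exp (- s)))"
    proof -
      \<comment> \<open>From s \<ge> 1/4 and t \<ge> 1, the exponent 2 t s splits into t / 4 for
        decay in time and s for integrability in \<xi>.\<close>
      have "t / 4 \<le> t * s" "s \<le> t * s"
        using s t mult_left_mono[of "1 / 4" s t] mult_right_mono[of 1 t s] by auto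
      then have "exp (- 2 * t * s) \<le> exp (- t / 4) * exp (- s)"
        by (simp add: mult_exp_exp)
      then show ?thesis
        by (intro mult_left_mono) auto
    qed
    also have "\<dots> = (real k + 1) ^ 4 * N\<^sup>2 * exp (- t / 4) * ((1 + norm \<xi>) ^ (2 * k) * exp (- s))"
      by (simp add: mult_ac)
    also have "\<dots> \<le> (real k + 1) ^ 4 * N\<^sup>2 * exp (- t / 4) * (4 ^ k * fact k * exp 1 * exp (- (1 / 2) * s))"
      unfolding s_def by (intro mult_left_mono one_plus_power_gaussian_le) auto
    finally show ?thesis
      by (simp add: mult_ac)
  qed
  finally show ?thesis
    by (simp add: s_def N_def a_def b_def mult.assoc)
qed

section \<open>Integration over frequency space and choice of constants\<close>

theorem theorem4p1:
  fixes \<gamma> :: real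
  assumes "\<gamma> \<ge> 0"
  shows "\<exists>C > 0. \<exists>c > 0.
    \<forall>u0 \<in> L2_space \<inter> L1w_space \<gamma>. \<forall>u1 \<in> L2_space \<inter> L1w_space \<gamma>.
    \<forall>v :: real ^ 'n::finite \<Rightarrow> complex. v = (\<lambda>x. u0 x + u1 x) \<longrightarrow>
    (\<forall>t \<ge> 1.
       (\<lambda>\<xi>. u_hat u0 u1 t \<xi> - profile (nat \<lfloor>\<gamma>\<rfloor>) v \<xi> * of_real (exp (- t * (norm \<xi>)\<^sup>2))) \<in> L2_space \<and>
       L2_norm (\<lambda>\<xi>. u_hat u0 u1 t \<xi> - profile (nat \<lfloor>\<gamma>\<rfloor>) v \<xi> * of_real (exp (- t * (norm \<xi>)\<^sup>2)))
         \<le> C * (1 + t) powr (- (real CARD('n) / 4) - \<gamma> / 2) * L1w_norm \<gamma> v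
           + C * exp (- c * t) * (L2_norm u0 + L2_norm u1 + L1w_norm (real (nat \<lfloor>\<gamma>\<rfloor>)) v))"
proof -
  define k where "k = nat \<lfloor>\<gamma>\<rfloor>"
  have k: "real k \<le> \<gamma>" "\<gamma> < real k + 1"
    using assms unfolding k_def by linarith+
  define n where "n = CARD('n)"
  define M1 where "M1 = 2 * (real k + 4)\<^sup>2 * (1 + fact (k + 1))"
  define M2 where "M2 = 2 * (real k + 1) ^ 4 * (4 ^ k * fact k * exp 1)"
  \<comment> \<open>\<open>M\<close> dominates the constants of both pointwise bounds; 324 also
    covers the 16 of the low frequencies.\<close>
  define M where "M = M1 + M2 + 324"
  \<comment> \<open>The three summands are the constant of the time decay, the constant of the L2
    bound for transforms, and the mass of exp(-|\<xi>|^2 / 2).\<close>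
  define P where "P = sqrt pi ^ n * 2 powr (\<gamma> + real n / 2) + (2 * pi) ^ n + sqrt (2 * pi) ^ n"
  have M1: "M1 \<ge> 0" and M2: "M2 \<ge> 0"
    unfolding M1_def M2_def by (auto intro!: mult_nonneg_nonneg add_nonneg_nonneg)
  then have M0: "M > 0"
    by (simp add: M_def)
  have P0: "P > 0"
    unfolding P_def by (intro add_pos_pos mult_pos_pos zero_less_power) auto
  have main: "(\<lambda>\<xi>. u_hat u0 u1 t \<xi> - profile k v \<xi> * of_real (exp (- t * (norm \<xi>)\<^sup>2))) \<in> L2_space \<and>
       L2_norm (\<lambda>\<xi>. u_hat u0 u1 t \<xi> - profile k v \<xi> * of_real (exp (- t * (norm \<xi>)\<^sup>2)))
         \<le> sqrt (M * P) * (1 + t) powr (- (real n / 4) - \<gamma> / 2) * L1w_norm \<gamma> v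
           + sqrt (M * P) * exp (- (1 / 8) * t) * (L2_norm u0 + L2_norm u1 + L1w_norm (real k) v)"
    if u: "u0 \<in> L2_space" "u0 \<in> L1w_space \<gamma>" "u1 \<in> L2_space" "u1 \<in> L1w_space \<gamma>"
      and v: "v = (\<lambda>x. u0 x + u1 x)" and t: "t \<ge> 1"
    for u0 u1 v :: "real ^ 'n \<Rightarrow> complex" and t :: real
  proof -
    define D where "D \<xi> = u_hat u0 u1 t \<xi> - profile k v \<xi> * of_real (exp (- t * (norm \<xi>)\<^sup>2))" for \<xi>
    define N where "N = L1w_norm \<gamma> v"
    define d where "d = L1w_norm (real k) v"
    \<comment> \<open>Contains the error terms of both regions at every \<xi>, so it bounds the
      squared error on the whole space and is integrated there without cutting the domain.\<close>
    define h where "h \<xi> = M * (N\<^sup>2 * t powr (- \<gamma>) * exp (- t * (norm \<xi>)\<^sup>2)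
        + exp (- t / 4) * ((cmod (fourier u0 \<xi>))\<^sup>2 + (cmod (fourier u1 \<xi>))\<^sup>2 + d\<^sup>2 * exp (- (1 / 2) * (norm \<xi>)\<^sup>2)))"
      for \<xi> :: "real ^ 'n"
    have nn: "N \<ge> 0" "d \<ge> 0" "L2_norm u0 \<ge> 0" "L2_norm u1 \<ge> 0"
      by (simp_all add: N_def d_def L1w_norm_nonneg L2_norm_def)
    have L1: "integrable lebesgue u0" "integrable lebesgue u1"
      using u by (auto intro: L1w_spaceD)
    have h_ge: "(cmod (D \<xi>))\<^sup>2 \<le> h \<xi>" for \<xi>
    proof -
      define A where "A = N\<^sup>2 * t powr (- \<gamma>) * exp (- t * (norm \<xi>)\<^sup>2)"
      define B where "B = exp (- t / 4) * ((cmod (fourier u0 \<xi>))\<^sup>2 + (cmod (fourier u1 \<xi>))\<^sup>2)"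
      define E where "E = exp (- t / 4) * (d\<^sup>2 * exp (- (1 / 2) * (norm \<xi>)\<^sup>2))"
      have ABE: "A \<ge> 0" "B \<ge> 0" "E \<ge> 0"
        by (auto simp: A_def B_def E_def)
      have h_eq: "h \<xi> = M * A + M * B + M * E"
        by (simp add: h_def A_def B_def E_def algebra_simps)
      have MA: "M1 * A \<le> M * A" "16 * B \<le> M * B" "324 * B \<le> M * B" "M2 * E \<le> M * E"
        using M1 M2 ABE by (auto simp: M_def intro!: mult_right_mono)
      have M0': "M * A \<ge> 0" "M * E \<ge> 0"
        using M0 ABE by auto
      show ?thesis
      proof (cases "norm \<xi> \<le> 1 / 2")
        case True
        have "(cmod (D \<xi>))\<^sup>2 \<le> M1 * A + 16 * B"
          unfolding D_def M1_def A_def B_def N_def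
          by (rule low_frequency_square_le[OF u(2,4) v k True t])
        then show ?thesis
          using MA M0' unfolding h_eq by linarith
      next
        case False
        have "(cmod (D \<xi>))\<^sup>2 \<le> 324 * B + M2 * E"
          unfolding D_def M2_def B_def E_def d_def
          using False by (intro high_frequency_square_le[OF _ _ v _ t] L1w_space_mono[OF u(2) k(1)] L1w_space_mono[OF u(4) k(1)]) auto
        then show ?thesis
          using MA M0' unfolding h_eq by linarith
      qed
    qed
    have D_meas [measurable]: "D \<in> borel_measurable borel"
      using borel_measurable_u_hat[OF L1] unfolding D_def[abs_def] by measurable
    have g_int: "integrable lborel (\<lambda>\<xi>::real^'n. exp (- a * (norm \<xi>)\<^sup>2))"
      and g_eq: "(LINT \<xi>|lborel. exp (- a * (norm (\<xi>::real^'n))\<^sup>2)) = sqrt (pi / a) ^ n" if "a > 0" for a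
      using has_bochner_integral_gaussian[OF that, where 'a = "real ^ 'n"]
      by (simp_all add: has_bochner_integral_iff n_def)
    note ints = g_int[of t] g_int[of "1 / 2"] integrable_fourier_square[OF L1(1) u(1)] integrable_fourier_square[OF L1(2) u(3)]
    have h_int: "integrable lborel h"
      unfolding h_def[abs_def] using ints t by auto
    have h_eq: "integral\<^sup>L lborel h = M * (N\<^sup>2 * t powr (- \<gamma>) * sqrt (pi / t) ^ n
        + exp (- t / 4) * ((LINT \<xi>|lborel. (cmod (fourier u0 \<xi>))\<^sup>2) + (LINT \<xi>|lborel. (cmod (fourier u1 \<xi>))\<^sup>2)
          + d\<^sup>2 * sqrt (2 * pi) ^ n))"
      unfolding h_def[abs_def] using ints g_eq[of t] g_eq[of "1 / 2"] t by (simp add: mult.commute[of 2 pi])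
    have D2_int: "integrable lborel (\<lambda>\<xi>. (cmod (D \<xi>))\<^sup>2)"
      by (rule Bochner_Integration.integrable_bound[OF h_int])
         (use h_ge in \<open>auto intro: order_trans[OF _ abs_ge_self]\<close>)
    have mem: "D \<in> L2_space"
      unfolding L2_space_def mem_Collect_eq
    proof
      show "D \<in> borel_measurable lebesgue"
        by (rule measurable_completion) simp
      show "integrable lebesgue (\<lambda>\<xi>. (cmod (D \<xi>))\<^sup>2)"
        using D2_int by (subst integrable_completion) auto
    qed
    define X where "X = (1 + t) powr (- (real n / 4) - \<gamma> / 2)"
    have decay: "t powr (- \<gamma>) * sqrt (pi / t) ^ n \<le> sqrt pi ^ n * 2 powr (\<gamma> + real n / 2) * X\<^sup>2"
    proof -
      have "t powr (- (1 / 2)) = inverse (sqrt t)"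
        unfolding powr_minus using t by (subst powr_half_sqrt) auto
      then have "sqrt (pi / t) = sqrt pi * t powr (- (1 / 2))"
        by (simp only: real_sqrt_divide divide_inverse[of "sqrt pi"])
      then have "sqrt (pi / t) ^ n = sqrt pi ^ n * t powr (- (real n / 2))"
        using t by (simp add: power_mult_distrib powr_power)
      then have "t powr (- \<gamma>) * sqrt (pi / t) ^ n = sqrt pi ^ n * (t powr (- \<gamma>) * t powr (- (real n / 2)))"
        by simp
      also have "t powr (- \<gamma>) * t powr (- (real n / 2)) = t powr (- (\<gamma> + real n / 2))"
        by (simp flip: powr_add)
      \<comment> \<open>For t \<ge> 1 one has (1 + t) / 2 \<le> t; a nonpositive exponent reverses
        this, so t is traded for 1 + t at the cost of the power of 2.\<close>
      also have "t powr (- (\<gamma> + real n / 2)) \<le> ((1 + t) / 2) powr (- (\<gamma> + real n / 2))"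
        using t assms by (intro powr_mono2') auto
      also have "\<dots> = 2 powr (\<gamma> + real n / 2) * (1 + t) powr (- (\<gamma> + real n / 2))"
        using t by (simp add: powr_divide powr_minus field_simps)
      also have "(1 + t) powr (- (\<gamma> + real n / 2)) = X\<^sup>2"
      proof -
        have "- (\<gamma> + real n / 2) = (- (real n / 4) - \<gamma> / 2) + (- (real n / 4) - \<gamma> / 2)"
          by linarith
        then show ?thesis
          by (simp only: X_def power2_eq_square powr_add)
      qed
      finally show ?thesis
        by simp
    qed
    \<comment> \<open>The squared error decays like exp(-t / 4), so the norm decays at rate 1/8, the
      value taken for c.\<close>
    define e where "e = exp (- (1 / 8) * t)"
    have e2: "exp (- t / 4) = e\<^sup>2"
      by (simp add: e_def power2_eq_square mult_exp_exp)
    have X0: "X \<ge> 0" and e0: "e \<ge> 0"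
      by (simp_all add: X_def e_def)
    define S where "S = L2_norm u0 + L2_norm u1 + d"
    have "integral\<^sup>L lborel (\<lambda>\<xi>. (cmod (D \<xi>))\<^sup>2) \<le> integral\<^sup>L lborel h"
      using D2_int h_int h_ge by (intro integral_mono) auto
    also have "\<dots> \<le> M * (N\<^sup>2 * (P * X\<^sup>2) + e\<^sup>2 * (P * S\<^sup>2))"
      unfolding h_eq e2 mult.assoc
    proof (intro mult_left_mono add_mono)
      have P1: "sqrt pi ^ n * 2 powr (\<gamma> + real n / 2) \<le> P" "(2 * pi) ^ n \<le> P" "sqrt (2 * pi) ^ n \<le> P"
        unfolding P_def by (auto intro!: add_nonneg_nonneg)
      show "t powr (- \<gamma>) * sqrt (pi / t) ^ n \<le> P * X\<^sup>2"
        using decay mult_right_mono[OF P1(1), of "X\<^sup>2"] by simp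
      have "(LINT \<xi>|lborel. (cmod (fourier u0 \<xi>))\<^sup>2) \<le> P * (L2_norm u0)\<^sup>2"
        using integral_fourier_square_le[OF L1(1) u(1)] mult_right_mono[OF P1(2), of "(L2_norm u0)\<^sup>2"]
        by (simp add: n_def)
      moreover have "(LINT \<xi>|lborel. (cmod (fourier u1 \<xi>))\<^sup>2) \<le> P * (L2_norm u1)\<^sup>2"
        using integral_fourier_square_le[OF L1(2) u(3)] mult_right_mono[OF P1(2), of "(L2_norm u1)\<^sup>2"]
        by (simp add: n_def)
      moreover have "d\<^sup>2 * sqrt (2 * pi) ^ n \<le> P * d\<^sup>2"
        using mult_right_mono[OF P1(3), of "d\<^sup>2"] by (simp add: mult.commute)
      ultimately have "(LINT \<xi>|lborel. (cmod (fourier u0 \<xi>))\<^sup>2) + (LINT \<xi>|lborel. (cmod (fourier u1 \<xi>))\<^sup>2) + d\<^sup>2 * sqrt (2 * pi) ^ n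
          \<le> P * ((L2_norm u0)\<^sup>2 + (L2_norm u1)\<^sup>2 + d\<^sup>2)"
        by (simp add: distrib_left)
      also have "\<dots> \<le> P * S\<^sup>2"
        using P0 nn by (intro mult_left_mono) (auto simp: S_def power2_eq_square algebra_simps)
      finally show "(LINT \<xi>|lborel. (cmod (fourier u0 \<xi>))\<^sup>2) + (LINT \<xi>|lborel. (cmod (fourier u1 \<xi>))\<^sup>2) + d\<^sup>2 * sqrt (2 * pi) ^ n
          \<le> P * S\<^sup>2" .
    qed (use M0 in auto)
    also have "\<dots> = M * P * ((X * N)\<^sup>2 + (e * S)\<^sup>2)"
      by (simp add: power_mult_distrib algebra_simps)
    \<comment> \<open>For nonnegative numbers the sum of squares is at most the square of the sum,
      so the square root gives the claimed sum with constant sqrt(M P).\<close>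
    also have "\<dots> \<le> M * P * (X * N + e * S)\<^sup>2"
      using M0 P0 nn X0 e0 by (intro mult_left_mono) (auto simp: power2_sum S_def)
    finally have "sqrt (integral\<^sup>L lborel (\<lambda>\<xi>. (cmod (D \<xi>))\<^sup>2)) \<le> sqrt (M * P * (X * N + e * S)\<^sup>2)"
      by (rule real_sqrt_le_mono)
    also have "\<dots> = sqrt (M * P) * (X * N + e * S)"
      using nn X0 e0 by (simp add: real_sqrt_mult S_def)
    also have "\<dots> = sqrt (M * P) * X * N + sqrt (M * P) * e * S"
      by (simp add: algebra_simps)
    finally have "L2_norm D \<le> sqrt (M * P) * X * N + sqrt (M * P) * e * S"
      by (simp add: L2_norm_def integral_completion)
    with mem show ?thesis
      unfolding D_def[abs_def] X_def N_def e_def S_def d_def by simp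
  qed
  show ?thesis
  proof (intro exI conjI ballI allI impI)
    show "sqrt (M * P) > 0" "(1 / 8 :: real) > 0"
      using M0 P0 by auto
  qed (use main in \<open>auto simp: k_def n_def\<close>)
qed

end
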